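(* (i) The space of rational functions in $Z=\{z_1,z_2,\dots\}$, i.e. the collection $\mathrm{Mould}^1(n)=\mathbb{C}(z_1,\dots,z_n)$, $n\ge1$, endowed with the partial compositions (for $P\in\mathrm{Mould}^1(m)$, $Q\in\mathrm{Mould}^1(n)$, $1\le k\le m$) $$(P\circ_kQ)(z_1,\dots,z_{m+n-1})=(z_kz_{k+1}\cdots z_{k+n-1}-1)\,P(z_1,\dots,z_{k-1},\,z_kz_{k+1}\cdots z_{k+n-1},\,z_{k+n},\dots,z_{m+n-1})\,Q(z_k,\dots,z_{k+n-1}),$$ acquires the structure of an operad, denoted by $\mathrm{Mould}^1$. (ii) $\mathrm{Mould}^1$ is isomorphic to Loday's operad $\lambda$-$\mathbf{RatFct}$ for $\lambda=1$. (iii) The rational functions $M_u(Z)$, $u$ ranging over (nonempty) packed words, span a suboperad of $\mathrm{Mould}^1$.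
   Context: Operads here are presented by partial compositions $\circ_k$: a family of vector spaces $\mathcal{O}(n)$, $n\ge1$, with bilinear maps $\circ_k:\mathcal{O}(m)\times\mathcal{O}(n)\to\mathcal{O}(m+n-1)$, $1\le k\le m$, satisfying the usual sequential and parallel associativity axioms and having a unit in $\mathcal{O}(1)$ (nonsymmetric operad). Loday's operad $1$-$\mathbf{RatFct}$: the spaces are $\mathbb{C}(x_1,\dots,x_n)$, $n\geq 1$, and the partial compositions are $$(P\circ'_kQ)(x_1,\dots,x_{m+n-1})=P\bigl(x_1,\dots,x_{k-1},\theta^1(x_k,\dots,x_{k+n-1}),x_{k+n},\dots,x_{m+n-1}\bigr)\,Q(x_k,\dots,x_{k+n-1}),$$ with $\theta^1(x_1,\dots,x_n)=\prod_{i=1}^n(x_i+1)-1$. Packed words: a word $u$ of length $n$ over the positive integers is packed if its set of letters is $\{1,\dots,m\}$ for some $m$; let $B_k$ be the set of positions of the letter $k$ in $u$. For a set $I$ of integers let $z^I=\prod_{i\in I}z_i$. Then $M_u(Z)=\prod_{k=1}^m\Bigl(\prod_{i=1}^kz^{B_i}-1\Bigr)^{-1}\in\mathbb{C}(z_1,\dots,z_n)$. *)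

theory Defs
  imports
    Complex_Main
    "HOL-Library.Poly_Mapping"
    "HOL-Computational_Algebra.Polynomial_Factorial"
begin

section \<open>Nonsymmetric operads in terms of partial compositions\<close>

text \<open>
  The component of arity \<open>n\<close> is a subspace \<open>Op n\<close> of an ambient vector space; only arities
  \<open>n \<ge> 1\<close> matter. As the components may overlap, the partial composition
  \<open>\<circ>\<^sub>k : Op m \<times> Op n \<rightarrow> Op (m + n - 1)\<close> carries its arities: it is \<open>pc m n k\<close>.
\<close>

definition is_operad_unit ::
    "(nat \<Rightarrow> 'a set) \<Rightarrow> (nat \<Rightarrow> nat \<Rightarrow> nat \<Rightarrow> 'a \<Rightarrow> 'a \<Rightarrow> 'a) \<Rightarrow> 'a \<Rightarrow> bool" where
  "is_operad_unit Op pc e \<longleftrightarrow>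
     e \<in> Op 1 \<and>
     (\<forall>n\<ge>1. \<forall>x\<in>Op n. pc 1 n 1 e x = x \<and> (\<forall>k\<in>{1..n}. pc n 1 k x e = x))"

locale ns_operad = vector_space scale
  for scale :: "'k::field \<Rightarrow> 'a::ab_group_add \<Rightarrow> 'a" +
  fixes Op :: "nat \<Rightarrow> 'a set"
    and pc :: "nat \<Rightarrow> nat \<Rightarrow> nat \<Rightarrow> 'a \<Rightarrow> 'a \<Rightarrow> 'a"
  assumes subspace_Op: "n \<ge> 1 \<Longrightarrow> subspace (Op n)"
    and pc_closed:
      "\<lbrakk>m \<ge> 1; n \<ge> 1; k \<in> {1..m}; x \<in> Op m; y \<in> Op n\<rbrakk> \<Longrightarrow> pc m n k x y \<in> Op (m + n - 1)"
    and pc_add_left: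
      "\<lbrakk>m \<ge> 1; n \<ge> 1; k \<in> {1..m}; x \<in> Op m; x' \<in> Op m; y \<in> Op n\<rbrakk> \<Longrightarrow>
         pc m n k (x + x') y = pc m n k x y + pc m n k x' y"
    and pc_scale_left:
      "\<lbrakk>m \<ge> 1; n \<ge> 1; k \<in> {1..m}; x \<in> Op m; y \<in> Op n\<rbrakk> \<Longrightarrow>
         pc m n k (scale c x) y = scale c (pc m n k x y)"
    and pc_add_right:
      "\<lbrakk>m \<ge> 1; n \<ge> 1; k \<in> {1..m}; x \<in> Op m; y \<in> Op n; y' \<in> Op n\<rbrakk> \<Longrightarrow>
         pc m n k x (y + y') = pc m n k x y + pc m n k x y'"
    and pc_scale_right:
      "\<lbrakk>m \<ge> 1; n \<ge> 1; k \<in> {1..m}; x \<in> Op m; y \<in> Op n\<rbrakk> \<Longrightarrow>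
         pc m n k x (scale c y) = scale c (pc m n k x y)"
    and sequential:
      "\<lbrakk>l \<ge> 1; m \<ge> 1; n \<ge> 1; i \<in> {1..l}; j \<in> {1..m}; x \<in> Op l; y \<in> Op m; z \<in> Op n\<rbrakk> \<Longrightarrow>
         pc (l + m - 1) n (i + j - 1) (pc l m i x y) z = pc l (m + n - 1) i x (pc m n j y z)"
    and parallel:
      "\<lbrakk>l \<ge> 1; m \<ge> 1; n \<ge> 1; 1 \<le> i; i < k; k \<le> l; x \<in> Op l; y \<in> Op m; z \<in> Op n\<rbrakk> \<Longrightarrow>
         pc (l + m - 1) n (k + m - 1) (pc l m i x y) z = pc (l + n - 1) m i (pc l n k x z) y"
    and has_unit: "\<exists>e. is_operad_unit Op pc e"

definition is_suboperad ::
    "('k::field \<Rightarrow> 'a::ab_group_add \<Rightarrow> 'a) \<Rightarrow> (nat \<Rightarrow> 'a set) \<Rightarrow>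
     (nat \<Rightarrow> nat \<Rightarrow> nat \<Rightarrow> 'a \<Rightarrow> 'a \<Rightarrow> 'a) \<Rightarrow> (nat \<Rightarrow> 'a set) \<Rightarrow> bool" where
  "is_suboperad scale Op pc S \<longleftrightarrow>
     ns_operad scale Op pc \<and>
     (\<forall>n\<ge>1. module.subspace scale (S n) \<and> S n \<subseteq> Op n) \<and>
     (\<forall>m\<ge>1. \<forall>n\<ge>1. \<forall>k\<in>{1..m}. \<forall>x\<in>S m. \<forall>y\<in>S n. pc m n k x y \<in> S (m + n - 1)) \<and>
     (\<exists>e\<in>S 1. is_operad_unit Op pc e)"

definition is_operad_iso ::
    "('k::field \<Rightarrow> 'a::ab_group_add \<Rightarrow> 'a) \<Rightarrow> (nat \<Rightarrow> 'a set) \<Rightarrow>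
     (nat \<Rightarrow> nat \<Rightarrow> nat \<Rightarrow> 'a \<Rightarrow> 'a \<Rightarrow> 'a) \<Rightarrow>
     ('k \<Rightarrow> 'b::ab_group_add \<Rightarrow> 'b) \<Rightarrow> (nat \<Rightarrow> 'b set) \<Rightarrow>
     (nat \<Rightarrow> nat \<Rightarrow> nat \<Rightarrow> 'b \<Rightarrow> 'b \<Rightarrow> 'b) \<Rightarrow> (nat \<Rightarrow> 'a \<Rightarrow> 'b) \<Rightarrow> bool" where
  "is_operad_iso scale Op pc scale' Op' pc' \<phi> \<longleftrightarrow>
     ns_operad scale Op pc \<and> ns_operad scale' Op' pc' \<and>
     (\<forall>n\<ge>1. bij_betw (\<phi> n) (Op n) (Op' n) \<and>
        (\<forall>x\<in>Op n. \<forall>y\<in>Op n. \<phi> n (x + y) = \<phi> n x + \<phi> n y) \<and>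
        (\<forall>c. \<forall>x\<in>Op n. \<phi> n (scale c x) = scale' c (\<phi> n x))) \<and>
     (\<forall>m\<ge>1. \<forall>n\<ge>1. \<forall>k\<in>{1..m}. \<forall>x\<in>Op m. \<forall>y\<in>Op n.
        \<phi> (m + n - 1) (pc m n k x y) = pc' m n k (\<phi> m x) (\<phi> n y)) \<and>
     (\<forall>e. is_operad_unit Op pc e \<longrightarrow> is_operad_unit Op' pc' (\<phi> 1 e))"

definition isomorphic_operads ::
    "('k::field \<Rightarrow> 'a::ab_group_add \<Rightarrow> 'a) \<Rightarrow> (nat \<Rightarrow> 'a set) \<Rightarrow>
     (nat \<Rightarrow> nat \<Rightarrow> nat \<Rightarrow> 'a \<Rightarrow> 'a \<Rightarrow> 'a) \<Rightarrow>
     ('k \<Rightarrow> 'b::ab_group_add \<Rightarrow> 'b) \<Rightarrow> (nat \<Rightarrow> 'b set) \<Rightarrow>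
     (nat \<Rightarrow> nat \<Rightarrow> nat \<Rightarrow> 'b \<Rightarrow> 'b \<Rightarrow> 'b) \<Rightarrow> bool" where
  "isomorphic_operads scale Op pc scale' Op' pc' \<longleftrightarrow>
     (\<exists>\<phi>. is_operad_iso scale Op pc scale' Op' pc' \<phi>)"


section \<open>Rational functions over the complex numbers\<close>

text \<open>
  Polynomials in the variables indexed by \<^typ>\<open>nat\<close> are finitely supported maps from monomials
  (finitely supported exponent functions) to coefficients, with the convolution product of
  \<^theory>\<open>HOL-Library.Poly_Mapping\<close>; rational functions are their fractions.
\<close>

type_synonym cpoly = "(nat \<Rightarrow>\<^sub>0 nat) \<Rightarrow>\<^sub>0 complex"
type_synonym ratfun = "cpoly fract"

definition rf_const :: "complex \<Rightarrow> ratfun" where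
  "rf_const c = to_fract (Poly_Mapping.single 0 c)"

definition Z :: "nat \<Rightarrow> ratfun" where
  "Z i = to_fract (Poly_Mapping.single (Poly_Mapping.single i 1) 1)"

definition rf_scale :: "complex \<Rightarrow> ratfun \<Rightarrow> ratfun" where
  "rf_scale c r = rf_const c * r"

definition poly_vars :: "cpoly \<Rightarrow> nat set" where
  "poly_vars p = (\<Union>m\<in>Poly_Mapping.keys p. Poly_Mapping.keys m)"

text \<open>The field of rational functions in the variables indexed by \<open>1, \<dots>, n\<close>.\<close>

definition RatFun :: "nat \<Rightarrow> ratfun set" where
  "RatFun n = {Fract p q | p q. q \<noteq> 0 \<and> poly_vars p \<subseteq> {1..n} \<and> poly_vars q \<subseteq> {1..n}}"

definition poly_subst :: "(nat \<Rightarrow> ratfun) \<Rightarrow> cpoly \<Rightarrow> ratfun" where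
  "poly_subst \<sigma> p =
     (\<Sum>m\<in>Poly_Mapping.keys p. rf_const (Poly_Mapping.lookup p m) *
        (\<Prod>i\<in>Poly_Mapping.keys m. \<sigma> i ^ Poly_Mapping.lookup m i))"

text \<open>
  Substitution of \<open>\<sigma> i\<close> for the variable \<open>i\<close> in a rational function: the value
  \<open>p(\<sigma>) / q(\<sigma>)\<close> is the same for all representations \<open>p / q\<close> with \<open>q(\<sigma>) \<noteq> 0\<close>,
  see \<open>rf_subst_Fract\<close> below.
\<close>

definition rf_subst :: "(nat \<Rightarrow> ratfun) \<Rightarrow> ratfun \<Rightarrow> ratfun" where
  "rf_subst \<sigma> r =
     (THE v. \<exists>p q. r = Fract p q \<and> poly_subst \<sigma> q \<noteq> 0 \<and> v = poly_subst \<sigma> p / poly_subst \<sigma> q)"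

lemma rf_const_0 [simp]: "rf_const 0 = 0"
  by (simp add: rf_const_def)

lemma rf_const_1 [simp]: "rf_const 1 = 1"
  by (simp add: rf_const_def)

lemma rf_const_add: "rf_const (a + b) = rf_const a + rf_const b"
  by (simp add: rf_const_def single_add)

lemma rf_const_mult: "rf_const (a * b) = rf_const a * rf_const b"
  by (simp add: rf_const_def mult_single flip: to_fract_mult)

interpretation rf: vector_space rf_scale
  by standard (simp_all add: rf_scale_def rf_const_add rf_const_mult algebra_simps)

definition mono_subst :: "(nat \<Rightarrow> ratfun) \<Rightarrow> (nat \<Rightarrow>\<^sub>0 nat) \<Rightarrow> ratfun" where
  "mono_subst \<sigma> m = (\<Prod>i\<in>Poly_Mapping.keys m. \<sigma> i ^ Poly_Mapping.lookup m i)"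

lemma mono_subst_superset:
  assumes "finite A" "Poly_Mapping.keys m \<subseteq> A"
  shows "mono_subst \<sigma> m = (\<Prod>i\<in>A. \<sigma> i ^ Poly_Mapping.lookup m i)"
  unfolding mono_subst_def using assms
  by (intro prod.mono_neutral_left) (auto simp: in_keys_iff)

lemma mono_subst_add: "mono_subst \<sigma> (m + m') = mono_subst \<sigma> m * mono_subst \<sigma> m'"
proof -
  let ?A = "Poly_Mapping.keys m \<union> Poly_Mapping.keys m'"
  have "mono_subst \<sigma> (m + m') = (\<Prod>i\<in>?A. \<sigma> i ^ Poly_Mapping.lookup (m + m') i)"
    by (rule mono_subst_superset) (use keys_add[of m m'] in auto)
  then show ?thesis
    by (simp add: mono_subst_superset[of ?A] lookup_add power_add prod.distrib)
qed

lemma poly_subst_superset: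
  assumes "finite A" "Poly_Mapping.keys p \<subseteq> A"
  shows "poly_subst \<sigma> p = (\<Sum>m\<in>A. rf_const (Poly_Mapping.lookup p m) * mono_subst \<sigma> m)"
  unfolding poly_subst_def mono_subst_def[symmetric] using assms
  by (intro sum.mono_neutral_left) (auto simp: in_keys_iff)

lemma poly_subst_0 [simp]: "poly_subst \<sigma> 0 = 0"
  by (simp add: poly_subst_def)

lemma poly_subst_single: "poly_subst \<sigma> (Poly_Mapping.single m c) = rf_const c * mono_subst \<sigma> m"
  by (subst poly_subst_superset[of "{m}"]) auto

lemma poly_subst_add: "poly_subst \<sigma> (p + q) = poly_subst \<sigma> p + poly_subst \<sigma> q"
proof -
  let ?A = "Poly_Mapping.keys p \<union> Poly_Mapping.keys q"
  have "poly_subst \<sigma> (p + q) =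
      (\<Sum>m\<in>?A. rf_const (Poly_Mapping.lookup (p + q) m) * mono_subst \<sigma> m)"
    by (rule poly_subst_superset) (use keys_add[of p q] in auto)
  then show ?thesis
    by (simp add: poly_subst_superset[of ?A] lookup_add rf_const_add distrib_right sum.distrib)
qed

lemma poly_subst_sum: "poly_subst \<sigma> (sum f A) = (\<Sum>x\<in>A. poly_subst \<sigma> (f x))"
  by (induction A rule: infinite_finite_induct) (simp_all add: poly_subst_add)

lemma cpoly_eq_sum_singles:
  fixes p :: cpoly
  shows "p = (\<Sum>m\<in>Poly_Mapping.keys p. Poly_Mapping.single m (Poly_Mapping.lookup p m))"
  by (rule poly_mapping_eqI) (auto simp: lookup_sum lookup_single when_def in_keys_iff)

lemma poly_subst_mult: "poly_subst \<sigma> (p * q) = poly_subst \<sigma> p * poly_subst \<sigma> q"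
proof -
  let ?s = "\<lambda>p m. Poly_Mapping.single m (Poly_Mapping.lookup p m) :: cpoly"
  let ?P = "Poly_Mapping.keys p" and ?Q = "Poly_Mapping.keys q"
  have "poly_subst \<sigma> (p * q) = poly_subst \<sigma> ((\<Sum>m\<in>?P. ?s p m) * (\<Sum>m\<in>?Q. ?s q m))"
    using cpoly_eq_sum_singles[of p] cpoly_eq_sum_singles[of q] by simp
  also have "\<dots> = (\<Sum>m\<in>?P. poly_subst \<sigma> (?s p m)) * (\<Sum>m\<in>?Q. poly_subst \<sigma> (?s q m))"
    by (simp add: sum_product poly_subst_sum mult_single poly_subst_single mono_subst_add
        rf_const_mult mult_ac)
  also have "\<dots> = poly_subst \<sigma> p * poly_subst \<sigma> q"
    using cpoly_eq_sum_singles[of p] cpoly_eq_sum_singles[of q]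
    by (simp flip: poly_subst_sum)
  finally show ?thesis .
qed

lemma rf_subst_Fract:
  assumes "poly_subst \<sigma> q \<noteq> 0"
  shows "rf_subst \<sigma> (Fract p q) = poly_subst \<sigma> p / poly_subst \<sigma> q"
  unfolding rf_subst_def
proof (rule the_equality)
  fix v
  assume "\<exists>p' q'. Fract p q = Fract p' q' \<and> poly_subst \<sigma> q' \<noteq> 0 \<and>
      v = poly_subst \<sigma> p' / poly_subst \<sigma> q'"
  then obtain p' q' where *: "Fract p q = Fract p' q'" "poly_subst \<sigma> q' \<noteq> 0"
      "v = poly_subst \<sigma> p' / poly_subst \<sigma> q'" by blast
  moreover have "q \<noteq> 0" "q' \<noteq> 0" using assms *(2) by auto
  ultimately have "p * q' = p' * q" by (simp add: eq_fract)
  then have "poly_subst \<sigma> p * poly_subst \<sigma> q' = poly_subst \<sigma> p' * poly_subst \<sigma> q"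
    by (metis poly_subst_mult)
  then show "v = poly_subst \<sigma> p / poly_subst \<sigma> q"
    using assms * by (simp add: frac_eq_eq)
qed (use assms in blast)


section \<open>The two operads and the functions attached to packed words\<close>

text \<open>Both operads have the spaces \<^const>\<open>RatFun\<close> and the scalar multiplication \<^const>\<open>rf_scale\<close>.\<close>

definition mould_pc :: "nat \<Rightarrow> nat \<Rightarrow> nat \<Rightarrow> ratfun \<Rightarrow> ratfun \<Rightarrow> ratfun" where
  "mould_pc m n k P Q =
     ((\<Prod>j\<in>{k..k+n-1}. Z j) - 1) *
     rf_subst (\<lambda>i. if i < k then Z i else if i = k then (\<Prod>j\<in>{k..k+n-1}. Z j) else Z (i + n - 1)) P *
     rf_subst (\<lambda>i. Z (k + i - 1)) Q"

definition loday_pc :: "nat \<Rightarrow> nat \<Rightarrow> nat \<Rightarrow> ratfun \<Rightarrow> ratfun \<Rightarrow> ratfun" where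
  "loday_pc m n k P Q =
     rf_subst (\<lambda>i. if i < k then Z i else if i = k then (\<Prod>j\<in>{k..k+n-1}. (Z j + 1)) - 1
                   else Z (i + n - 1)) P *
     rf_subst (\<lambda>i. Z (k + i - 1)) Q"

definition packed :: "nat list \<Rightarrow> bool" where
  "packed u \<longleftrightarrow> (\<exists>m. set u = {1..m})"

text \<open>Positions are counted from 1, whereas list indices start at 0.\<close>

definition letter_positions :: "nat list \<Rightarrow> nat \<Rightarrow> nat set" where
  "letter_positions u k = {i \<in> {1..length u}. u ! (i - 1) = k}"

text \<open>For a packed word \<open>u\<close> with set of letters \<open>{1..m}\<close>, \<open>card (set u)\<close> is \<open>m\<close>.\<close>

definition packed_M :: "nat list \<Rightarrow> ratfun" where
  "packed_M u =
     (\<Prod>k\<in>{1..card (set u)}. inverse ((\<Prod>i\<in>{1..k}. \<Prod>j\<in>letter_positions u i. Z j) - 1))"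

definition packed_span :: "nat \<Rightarrow> ratfun set" where
  "packed_span n = module.span rf_scale {packed_M u | u. packed u \<and> length u = n}"

end

theory Submission
  imports Defs "HOL-Library.Disjoint_Sets"
begin

text \<open>
  A substitution of algebraically independent functions for the variables is a homomorphism of
  fields of rational functions, and two such homomorphisms that agree on the variables are equal.
  Hence identities between substitutions need to be checked on the variables only.

  The substitutions in the partial composition of moulds replace each variable \<open>i\<close> by
  a product \<open>z^(e i)\<close>, where the sets \<open>e i\<close> are pairwise disjoint and nonempty. They send
  \<open>z^X\<close> to \<open>z^(\<Union>i\<in>X. e i)\<close>, so composing them means composing the maps \<open>e\<close>. The sets belonging
  to \<open>\<circ>\<^sub>k\<close> are the fibres of the monotone map \<open>collapse k n\<close> that squeezes the interval
  \<open>{k..k + n - 1}\<close> to the point \<open>k\<close>. The two associativity axioms thus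
  become identities between composites of such maps (\<open>collapse_nested\<close>, \<open>collapse_disjoint\<close>), and the
  extra factors \<open>z\<^sub>k \<dots> z\<^sub>k\<^sub>+\<^sub>n\<^sub>-\<^sub>1 - 1\<close> match on both sides since they are themselves of the form \<open>z^X - 1\<close>.
  The unit is \<open>1 / (z\<^sub>1 - 1)\<close>.

  The Loday operad is the same structure in the coordinates \<open>x = z - 1\<close>, with the extra factor
  absorbed: \<open>P(z) \<mapsto> ((x\<^sub>1 + 1) \<dots> (x\<^sub>n + 1) - 1) P(x\<^sub>1 + 1, \<dots>, x\<^sub>n + 1)\<close> is a linear bijection in
  each arity and turns one partial composition into the other (\<open>mould_to_loday_pc\<close>). The operad
  axioms for the Loday composition follow by transport.

  For packed words, note that \<open>M\<^sub>u\<close> depends only on the strictly increasing chain of sets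
  \<open>{} \<subset> X\<^sub>1 \<subset> \<dots> \<subset> X\<^sub>m = {1..n}\<close>, where \<open>X\<^sub>k\<close> consists of the positions of letters at most \<open>k\<close>: it is
  \<open>\<Prod>k. 1 / (z^(X\<^sub>k) - 1)\<close>. In \<open>M\<^sub>u \<circ>\<^sub>k M\<^sub>v\<close> the extra factor cancels the last factor of \<open>M\<^sub>v\<close>. The
  remaining factors of \<open>M\<^sub>v\<close> and those factors of \<open>M\<^sub>u\<close> whose sets avoid \<open>k\<close> involve disjoint sets of
  variables, and the identity
  \<open>1 / ((a - 1) (b - 1)) = (1 + 1 / (a - 1) + 1 / (b - 1)) / (a b - 1)\<close>
  expands their product as a sum over chains ending at the union of the two top sets
  (\<open>chain_fun_mult\<close>, a quasi-shuffle product). The other factors of \<open>M\<^sub>u\<close> belong to sets that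
  properly contain this union and extend these chains (\<open>chain_fun_insert\<close>).
\<close>

section \<open>The fields of rational functions and their substitutions\<close>

lemma poly_vars_add: "poly_vars (p + q) \<subseteq> poly_vars p \<union> poly_vars q"
  using keys_add[of p q] by (auto simp: poly_vars_def)

lemma poly_vars_mult: "poly_vars (p * q) \<subseteq> poly_vars p \<union> poly_vars q"
proof -
  have "Poly_Mapping.keys m \<subseteq> poly_vars p \<union> poly_vars q" if m: "m \<in> Poly_Mapping.keys (p * q)" for m
  proof -
    obtain a b where "m = a + b" "a \<in> Poly_Mapping.keys p" "b \<in> Poly_Mapping.keys q"
      using m keys_mult[of p q] by blast
    then show ?thesis
      using keys_add[of a b] by (auto simp: poly_vars_def)
  qed
  then show ?thesis by (auto simp: poly_vars_def)
qed

lemma poly_vars_single: "poly_vars (Poly_Mapping.single m c) \<subseteq> Poly_Mapping.keys m"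
  by (auto simp: poly_vars_def)

lemma RatFunE:
  assumes "r \<in> RatFun n"
  obtains p q where "r = Fract p q" "q \<noteq> 0" "poly_vars p \<subseteq> {1..n}" "poly_vars q \<subseteq> {1..n}"
  using assms by (auto simp: RatFun_def)

lemma RatFunI:
  "q \<noteq> 0 \<Longrightarrow> poly_vars p \<subseteq> {1..n} \<Longrightarrow> poly_vars q \<subseteq> {1..n} \<Longrightarrow> Fract p q \<in> RatFun n"
  by (auto simp: RatFun_def)

lemma RatFun_to_fract: "poly_vars p \<subseteq> {1..n} \<Longrightarrow> to_fract p \<in> RatFun n"
  using RatFunI[of 1 p n] by (auto simp: to_fract_def poly_vars_def)

lemma RatFun_const [simp]: "rf_const c \<in> RatFun n"
  unfolding rf_const_def by (rule RatFun_to_fract) (use poly_vars_single[of 0 c] in auto)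

lemma RatFun_0 [simp]: "0 \<in> RatFun n" and RatFun_1 [simp]: "1 \<in> RatFun n"
  using RatFun_const[of 0 n] RatFun_const[of 1 n] by simp_all

lemma RatFun_Z [simp]: "i \<in> {1..n} \<Longrightarrow> Z i \<in> RatFun n"
  unfolding Z_def by (rule RatFun_to_fract) (use poly_vars_single[of "Poly_Mapping.single i 1" 1] in auto)

lemma RatFun_add [simp]: "r \<in> RatFun n \<Longrightarrow> s \<in> RatFun n \<Longrightarrow> r + s \<in> RatFun n"
proof (elim RatFunE)
  fix p q p' q' :: cpoly
  assume *: "r = Fract p q" "q \<noteq> 0" "poly_vars p \<subseteq> {1..n}" "poly_vars q \<subseteq> {1..n}"
    "s = Fract p' q'" "q' \<noteq> 0" "poly_vars p' \<subseteq> {1..n}" "poly_vars q' \<subseteq> {1..n}"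
  have "poly_vars (p * q' + p' * q) \<subseteq> {1..n}"
    using * poly_vars_mult[of p q'] poly_vars_mult[of p' q] poly_vars_add[of "p * q'" "p' * q"] by blast
  then have "Fract (p * q' + p' * q) (q * q') \<in> RatFun n"
    using * poly_vars_mult[of q q'] by (intro RatFunI) auto
  with * show ?thesis by simp
qed

lemma RatFun_mult [simp]: "r \<in> RatFun n \<Longrightarrow> s \<in> RatFun n \<Longrightarrow> r * s \<in> RatFun n"
proof (elim RatFunE)
  fix p q p' q' :: cpoly
  assume *: "r = Fract p q" "q \<noteq> 0" "poly_vars p \<subseteq> {1..n}" "poly_vars q \<subseteq> {1..n}"
    "s = Fract p' q'" "q' \<noteq> 0" "poly_vars p' \<subseteq> {1..n}" "poly_vars q' \<subseteq> {1..n}"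
  have "Fract (p * p') (q * q') \<in> RatFun n"
    using * poly_vars_mult[of p p'] poly_vars_mult[of q q'] by (intro RatFunI) auto
  with * show ?thesis by simp
qed

lemma RatFun_inverse [simp]: "r \<in> RatFun n \<Longrightarrow> inverse r \<in> RatFun n"
proof (elim RatFunE)
  fix p q :: cpoly
  assume *: "r = Fract p q" "q \<noteq> 0" "poly_vars p \<subseteq> {1..n}" "poly_vars q \<subseteq> {1..n}"
  show ?thesis
  proof (cases "p = 0")
    case True
    with * show ?thesis by (simp add: fract_collapse)
  next
    case False
    with * show ?thesis using RatFunI[of p q n] by simp
  qed
qed

lemma RatFun_scale [simp]: "r \<in> RatFun n \<Longrightarrow> rf_scale c r \<in> RatFun n"
  by (simp add: rf_scale_def)

lemma rf_const_uminus: "rf_const (- c) = - rf_const c"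
  using rf_const_add[of "- c" c] by (simp add: eq_neg_iff_add_eq_0)

lemma RatFun_diff [simp]: "r \<in> RatFun n \<Longrightarrow> s \<in> RatFun n \<Longrightarrow> r - s \<in> RatFun n"
  using RatFun_add[of r n "rf_const (- 1) * s"] RatFun_mult[of "rf_const (- 1)" n s] RatFun_const[of "-1" n]
  by (simp add: rf_const_uminus)

lemma RatFun_prod: "(\<And>i. i \<in> A \<Longrightarrow> f i \<in> RatFun n) \<Longrightarrow> prod f A \<in> RatFun n"
  by (induction A rule: infinite_finite_induct) auto

lemma RatFun_sum: "(\<And>i. i \<in> A \<Longrightarrow> f i \<in> RatFun n) \<Longrightarrow> sum f A \<in> RatFun n"
  by (induction A rule: infinite_finite_induct) auto

lemma RatFun_power [simp]: "r \<in> RatFun n \<Longrightarrow> r ^ k \<in> RatFun n"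
  by (induction k) auto

lemma subspace_RatFun: "rf.subspace (RatFun n)"
  by (auto simp: rf.subspace_def)

lemma poly_subst_in_RatFun:
  assumes "poly_vars p \<subseteq> {1..n}" "\<And>i. i \<in> {1..n} \<Longrightarrow> \<sigma> i \<in> RatFun N"
  shows "poly_subst \<sigma> p \<in> RatFun N"
  unfolding poly_subst_def using assms
  by (intro RatFun_sum RatFun_mult RatFun_prod RatFun_const RatFun_power) (auto simp: poly_vars_def)

lemma poly_subst_cong:
  assumes "\<And>i. i \<in> poly_vars p \<Longrightarrow> \<sigma> i = \<tau> i"
  shows "poly_subst \<sigma> p = poly_subst \<tau> p"
  unfolding poly_subst_def using assms
  by (intro sum.cong prod.cong refl arg_cong2[where f = "(*)"] arg_cong2[where f = "(^)"])
     (auto simp: poly_vars_def)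

lemma poly_subst_1 [simp]: "poly_subst \<sigma> 1 = 1"
  using poly_subst_single[of \<sigma> 0 1] by (simp add: mono_subst_def)

lemma poly_subst_const [simp]: "poly_subst \<sigma> (Poly_Mapping.single 0 c) = rf_const c"
  by (simp add: poly_subst_single mono_subst_def)

lemma poly_subst_prod: "poly_subst \<sigma> (prod f A) = (\<Prod>x\<in>A. poly_subst \<sigma> (f x))"
  by (induction A rule: infinite_finite_induct) (simp_all add: poly_subst_mult)

lemma poly_subst_power: "poly_subst \<sigma> (p ^ k) = poly_subst \<sigma> p ^ k"
  by (induction k) (simp_all add: poly_subst_mult)

lemma poly_subst_var [simp]:
  "poly_subst \<sigma> (Poly_Mapping.single (Poly_Mapping.single i 1) 1) = \<sigma> i"
  by (simp add: poly_subst_single mono_subst_def)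

lemma to_fract_prod: "to_fract (prod f A) = (\<Prod>x\<in>A. to_fract (f x))"
  by (induction A rule: infinite_finite_induct) simp_all

lemma to_fract_power: "to_fract (p ^ k) = to_fract p ^ k"
  by (induction k) simp_all

text \<open>
  Evaluation at the generic point recovers the polynomial; this is what turns a left inverse on
  the variables into injectivity.
\<close>

lemma poly_subst_Z: "poly_subst Z p = to_fract p"
proof -
  have var_power: "Poly_Mapping.single (Poly_Mapping.single i 1) (1::complex) ^ k
      = Poly_Mapping.single (Poly_Mapping.single i k) 1" for i k :: nat
    by (induction k) (simp_all add: mult_single flip: single_add)
  have prod_single: "(\<Prod>i\<in>A. Poly_Mapping.single (h i) (1::complex)) = Poly_Mapping.single (sum h A) 1"
    for A :: "nat set" and h :: "nat \<Rightarrow> (nat \<Rightarrow>\<^sub>0 nat)"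
    by (induction A rule: infinite_finite_induct) (simp_all add: mult_single)
  have sum_single: "(\<Sum>i\<in>Poly_Mapping.keys m. Poly_Mapping.single i (Poly_Mapping.lookup m i)) = m"
    for m :: "nat \<Rightarrow>\<^sub>0 nat"
    by (rule poly_mapping_eqI) (auto simp: lookup_sum lookup_single when_def in_keys_iff)
  have "mono_subst Z m = to_fract (Poly_Mapping.single m 1)" for m
    unfolding mono_subst_def Z_def
    by (simp only: to_fract_power[symmetric] to_fract_prod[symmetric] var_power prod_single sum_single)
  then have "poly_subst Z (Poly_Mapping.single m c) = to_fract (Poly_Mapping.single m c)" for m c
    by (simp add: poly_subst_single rf_const_def mult_single flip: to_fract_mult)
  then have "poly_subst Z (\<Sum>m\<in>Poly_Mapping.keys p. Poly_Mapping.single m (Poly_Mapping.lookup p m))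
      = to_fract (\<Sum>m\<in>Poly_Mapping.keys p. Poly_Mapping.single m (Poly_Mapping.lookup p m))"
    by (simp add: poly_subst_sum to_fract_sum)
  then show ?thesis by (simp flip: cpoly_eq_sum_singles)
qed

text \<open>
  Nonvanishing on all nonzero polynomials in the first \<open>n\<close> variables, which is exactly what makes
  \<open>rf_subst \<sigma>\<close> well defined on all of \<open>RatFun n\<close>, denominators included.
\<close>

definition alg_indep :: "nat \<Rightarrow> (nat \<Rightarrow> ratfun) \<Rightarrow> bool" where
  "alg_indep n \<sigma> \<longleftrightarrow> (\<forall>q. q \<noteq> 0 \<longrightarrow> poly_vars q \<subseteq> {1..n} \<longrightarrow> poly_subst \<sigma> q \<noteq> 0)"

text \<open>
  A second substitution \<open>\<tau>\<close> that recovers the variables from the polynomials \<open>s i\<close> recovers every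
  polynomial \<open>q\<close> from \<open>q(s)\<close>, so \<open>q(s) = 0\<close> forces \<open>q = 0\<close>. As \<open>\<tau>\<close> is only applied to polynomials, it
  may be degenerate: it can send variables to constants.
\<close>

lemma alg_indep_left_inverse:
  assumes left_inv: "\<And>i. i \<in> {1..n} \<Longrightarrow> poly_subst \<tau> (s i) = Z i"
  shows "alg_indep n (\<lambda>i. to_fract (s i))"
  unfolding alg_indep_def
proof (intro allI impI notI)
  fix q assume q: "q \<noteq> 0" "poly_vars q \<subseteq> {1..n}" "poly_subst (\<lambda>i. to_fract (s i)) q = 0"
  \<comment> \<open>\<open>q'\<close> is \<open>q(s)\<close>, computed inside the polynomial ring so that \<open>\<tau>\<close> can be applied to it.\<close>
  define q' where "q' = (\<Sum>m\<in>Poly_Mapping.keys q. Poly_Mapping.single 0 (Poly_Mapping.lookup q m) *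
        (\<Prod>i\<in>Poly_Mapping.keys m. s i ^ Poly_Mapping.lookup m i))"
  have "poly_subst (\<lambda>i. to_fract (s i)) q = to_fract q'"
    by (simp add: poly_subst_def q'_def to_fract_sum to_fract_prod to_fract_power rf_const_def)
  with q have "q' = 0" by simp
  then have "0 = poly_subst \<tau> q'" by simp
  also have "\<dots> = poly_subst (\<lambda>i. poly_subst \<tau> (s i)) q"
    unfolding q'_def
    by (simp add: poly_subst_sum poly_subst_mult poly_subst_prod poly_subst_power)
       (simp add: poly_subst_def)
  also have "\<dots> = poly_subst Z q"
    by (rule poly_subst_cong) (use q left_inv in auto)
  finally show False using q by (simp add: poly_subst_Z)
qed

lemma alg_indep_Z: "alg_indep n Z"
  by (auto simp: alg_indep_def poly_subst_Z)

lemma rf_subst_RatFunE: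
  assumes "alg_indep n \<sigma>" "r \<in> RatFun n"
  obtains p q where "r = Fract p q" "q \<noteq> 0" "poly_vars p \<subseteq> {1..n}" "poly_vars q \<subseteq> {1..n}"
    "poly_subst \<sigma> q \<noteq> 0" "rf_subst \<sigma> r = poly_subst \<sigma> p / poly_subst \<sigma> q"
proof -
  obtain p q where "r = Fract p q" "q \<noteq> 0" "poly_vars p \<subseteq> {1..n}" "poly_vars q \<subseteq> {1..n}"
    using assms(2) by (rule RatFunE)
  with assms(1) show ?thesis
    by (intro that) (auto simp: alg_indep_def rf_subst_Fract)
qed

lemma rf_subst_to_fract: "rf_subst \<sigma> (to_fract p) = poly_subst \<sigma> p"
  by (simp add: to_fract_def rf_subst_Fract)

lemma rf_subst_const [simp]: "rf_subst \<sigma> (rf_const c) = rf_const c"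
  using rf_subst_to_fract[of \<sigma> "Poly_Mapping.single 0 c"] by (simp flip: rf_const_def)

lemma rf_subst_1 [simp]: "rf_subst \<sigma> 1 = 1"
  using rf_subst_const[of \<sigma> 1] by simp

lemma rf_subst_0 [simp]: "rf_subst \<sigma> 0 = 0"
  using rf_subst_const[of \<sigma> 0] by simp

lemma rf_subst_Z [simp]: "rf_subst \<sigma> (Z i) = \<sigma> i"
  unfolding Z_def by (simp only: rf_subst_to_fract poly_subst_var)

lemma rf_subst_add:
  assumes "alg_indep n \<sigma>" "r \<in> RatFun n" "s \<in> RatFun n"
  shows "rf_subst \<sigma> (r + s) = rf_subst \<sigma> r + rf_subst \<sigma> s"
proof -
  obtain p q where *: "r = Fract p q" "q \<noteq> 0" "poly_subst \<sigma> q \<noteq> 0"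
    "rf_subst \<sigma> r = poly_subst \<sigma> p / poly_subst \<sigma> q"
    using assms by (blast elim: rf_subst_RatFunE)
  obtain p' q' where **: "s = Fract p' q'" "q' \<noteq> 0" "poly_subst \<sigma> q' \<noteq> 0"
    "rf_subst \<sigma> s = poly_subst \<sigma> p' / poly_subst \<sigma> q'"
    using assms by (blast elim: rf_subst_RatFunE)
  have "rf_subst \<sigma> (Fract (p * q' + p' * q) (q * q'))
      = poly_subst \<sigma> (p * q' + p' * q) / poly_subst \<sigma> (q * q')"
    by (rule rf_subst_Fract) (simp add: poly_subst_mult * **)
  with * ** show ?thesis
    by (simp add: poly_subst_mult poly_subst_add add_frac_eq mult_ac)
qed

lemma rf_subst_mult:
  assumes "alg_indep n \<sigma>" "r \<in> RatFun n" "s \<in> RatFun n"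
  shows "rf_subst \<sigma> (r * s) = rf_subst \<sigma> r * rf_subst \<sigma> s"
proof -
  obtain p q where *: "r = Fract p q" "q \<noteq> 0" "poly_subst \<sigma> q \<noteq> 0"
    "rf_subst \<sigma> r = poly_subst \<sigma> p / poly_subst \<sigma> q"
    using assms by (blast elim: rf_subst_RatFunE)
  obtain p' q' where **: "s = Fract p' q'" "q' \<noteq> 0" "poly_subst \<sigma> q' \<noteq> 0"
    "rf_subst \<sigma> s = poly_subst \<sigma> p' / poly_subst \<sigma> q'"
    using assms by (blast elim: rf_subst_RatFunE)
  have "rf_subst \<sigma> (Fract (p * p') (q * q')) = poly_subst \<sigma> (p * p') / poly_subst \<sigma> (q * q')"
    by (rule rf_subst_Fract) (simp add: poly_subst_mult * **)
  with * ** show ?thesis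
    by (simp add: poly_subst_mult)
qed

lemma rf_subst_diff:
  assumes "alg_indep n \<sigma>" "r \<in> RatFun n" "s \<in> RatFun n"
  shows "rf_subst \<sigma> (r - s) = rf_subst \<sigma> r - rf_subst \<sigma> s"
proof -
  have "rf_subst \<sigma> (r - s + s) = rf_subst \<sigma> (r - s) + rf_subst \<sigma> s"
    using assms by (intro rf_subst_add) auto
  then show ?thesis by simp
qed

lemma rf_subst_nonzero:
  assumes "alg_indep n \<sigma>" "r \<in> RatFun n" "r \<noteq> 0"
  shows "rf_subst \<sigma> r \<noteq> 0"
proof
  assume "rf_subst \<sigma> r = 0"
  then have "rf_subst \<sigma> (r * inverse r) = 0"
    using assms by (subst rf_subst_mult[OF assms(1)]) auto
  with assms show False by simp
qed

lemma rf_subst_inverse: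
  assumes "alg_indep n \<sigma>" "r \<in> RatFun n"
  shows "rf_subst \<sigma> (inverse r) = inverse (rf_subst \<sigma> r)"
proof (cases "r = 0")
  case False
  have "rf_subst \<sigma> (r * inverse r) = rf_subst \<sigma> r * rf_subst \<sigma> (inverse r)"
    using assms by (intro rf_subst_mult) auto
  with False show ?thesis by (simp add: inverse_unique)
qed simp

lemma rf_subst_sum:
  assumes "alg_indep n \<sigma>" "\<And>i. i \<in> A \<Longrightarrow> f i \<in> RatFun n"
  shows "rf_subst \<sigma> (sum f A) = (\<Sum>i\<in>A. rf_subst \<sigma> (f i))"
  using assms(2)
  by (induction A rule: infinite_finite_induct) (simp_all add: rf_subst_add[OF assms(1)] RatFun_sum)

lemma rf_subst_prod:
  assumes "alg_indep n \<sigma>" "\<And>i. i \<in> A \<Longrightarrow> f i \<in> RatFun n"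
  shows "rf_subst \<sigma> (prod f A) = (\<Prod>i\<in>A. rf_subst \<sigma> (f i))"
  using assms(2)
  by (induction A rule: infinite_finite_induct) (simp_all add: rf_subst_mult[OF assms(1)] RatFun_prod)

lemma rf_subst_power:
  assumes "alg_indep n \<sigma>" "r \<in> RatFun n"
  shows "rf_subst \<sigma> (r ^ k) = rf_subst \<sigma> r ^ k"
  by (induction k) (simp_all add: rf_subst_mult[OF assms(1)] assms)

lemma rf_subst_scale:
  assumes "alg_indep n \<sigma>" "r \<in> RatFun n"
  shows "rf_subst \<sigma> (rf_scale c r) = rf_scale c (rf_subst \<sigma> r)"
  by (simp add: rf_scale_def rf_subst_mult[OF assms(1)] assms)

lemma rf_subst_in_RatFun:
  assumes "alg_indep n \<sigma>" "r \<in> RatFun n" "\<And>i. i \<in> {1..n} \<Longrightarrow> \<sigma> i \<in> RatFun N"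
  shows "rf_subst \<sigma> r \<in> RatFun N"
proof -
  obtain p q where "poly_vars p \<subseteq> {1..n}" "poly_vars q \<subseteq> {1..n}"
    "rf_subst \<sigma> r = poly_subst \<sigma> p / poly_subst \<sigma> q"
    using assms by (blast elim: rf_subst_RatFunE)
  then show ?thesis
    using assms by (auto simp: divide_inverse intro!: RatFun_mult RatFun_inverse poly_subst_in_RatFun)
qed

lemma rf_subst_cong:
  assumes "alg_indep n \<sigma>" "r \<in> RatFun n" "\<And>i. i \<in> {1..n} \<Longrightarrow> \<sigma> i = \<tau> i"
  shows "rf_subst \<sigma> r = rf_subst \<tau> r"
proof -
  obtain p q where *: "r = Fract p q" "poly_vars p \<subseteq> {1..n}" "poly_vars q \<subseteq> {1..n}"
    "poly_subst \<sigma> q \<noteq> 0" "rf_subst \<sigma> r = poly_subst \<sigma> p / poly_subst \<sigma> q"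
    using assms by (blast elim: rf_subst_RatFunE)
  have "poly_subst \<sigma> p = poly_subst \<tau> p" "poly_subst \<sigma> q = poly_subst \<tau> q"
    using * assms(3) by (auto intro!: poly_subst_cong)
  with * show ?thesis by (simp add: rf_subst_Fract)
qed

lemma rf_subst_poly_subst:
  assumes "alg_indep N \<tau>" "poly_vars p \<subseteq> {1..n}" "\<And>i. i \<in> {1..n} \<Longrightarrow> \<sigma> i \<in> RatFun N"
  shows "rf_subst \<tau> (poly_subst \<sigma> p) = poly_subst (\<lambda>i. rf_subst \<tau> (\<sigma> i)) p"
proof -
  have \<sigma>: "\<sigma> i \<in> RatFun N" if "m \<in> Poly_Mapping.keys p" "i \<in> Poly_Mapping.keys m" for m i
    using assms that by (auto simp: poly_vars_def)
  show ?thesis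
    unfolding poly_subst_def
    by (simp add: rf_subst_sum[OF assms(1)] rf_subst_mult[OF assms(1)] rf_subst_prod[OF assms(1)]
        rf_subst_power[OF assms(1)] RatFun_prod \<sigma>)
qed

text \<open>
  The composite vanishes on a polynomial \<open>q\<close> only if \<open>rf_subst \<tau>\<close> vanishes on \<open>q(\<sigma>)\<close>, which is
  nonzero; a homomorphism of fields is injective.
\<close>

lemma alg_indep_comp:
  assumes "alg_indep n \<sigma>" "\<And>i. i \<in> {1..n} \<Longrightarrow> \<sigma> i \<in> RatFun N" "alg_indep N \<tau>"
  shows "alg_indep n (\<lambda>i. rf_subst \<tau> (\<sigma> i))"
  unfolding alg_indep_def
proof (intro allI impI)
  fix q assume q: "q \<noteq> 0" "poly_vars q \<subseteq> {1..n}"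
  then have "rf_subst \<tau> (poly_subst \<sigma> q) \<noteq> 0"
    using assms by (intro rf_subst_nonzero[of N] poly_subst_in_RatFun) (auto simp: alg_indep_def)
  with q show "poly_subst (\<lambda>i. rf_subst \<tau> (\<sigma> i)) q \<noteq> 0"
    using rf_subst_poly_subst[of N \<tau> q n \<sigma>] assms by simp
qed

text \<open>
  The tool for all identities between substitutions below: it reduces them to the
  values on the variables.
\<close>

lemma rf_subst_comp:
  assumes "alg_indep n \<sigma>" "\<And>i. i \<in> {1..n} \<Longrightarrow> \<sigma> i \<in> RatFun N" "alg_indep N \<tau>" "r \<in> RatFun n"
  shows "rf_subst \<tau> (rf_subst \<sigma> r) = rf_subst (\<lambda>i. rf_subst \<tau> (\<sigma> i)) r"
proof -
  obtain p q where *: "r = Fract p q" "q \<noteq> 0" "poly_vars p \<subseteq> {1..n}" "poly_vars q \<subseteq> {1..n}"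
    "rf_subst \<sigma> r = poly_subst \<sigma> p / poly_subst \<sigma> q"
    using assms by (blast elim: rf_subst_RatFunE)
  have mem: "poly_subst \<sigma> p \<in> RatFun N" "poly_subst \<sigma> q \<in> RatFun N"
    using * assms by (auto intro!: poly_subst_in_RatFun)
  have "poly_subst (\<lambda>i. rf_subst \<tau> (\<sigma> i)) q \<noteq> 0"
    using alg_indep_comp[OF assms(1-3)] * by (auto simp: alg_indep_def)
  with * mem assms show ?thesis
    using rf_subst_poly_subst[OF assms(3) *(3) assms(2)] rf_subst_poly_subst[OF assms(3) *(4) assms(2)]
    by (simp add: rf_subst_Fract divide_inverse rf_subst_mult[of N] rf_subst_inverse[of N])
qed

lemma rf_subst_ident:
  assumes "r \<in> RatFun n" "\<And>i. i \<in> {1..n} \<Longrightarrow> \<sigma> i = Z i"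
  shows "rf_subst \<sigma> r = r"
proof -
  obtain p q where *: "r = Fract p q" "q \<noteq> 0"
    "rf_subst Z r = poly_subst Z p / poly_subst Z q"
    using assms alg_indep_Z by (blast elim: rf_subst_RatFunE)
  then have "rf_subst Z r = r"
    by (simp add: poly_subst_Z to_fract_def divide_fract)
  then show ?thesis
    using rf_subst_cong[OF alg_indep_Z assms(1), of \<sigma>] assms(2) by simp
qed

section \<open>Substitution of products of disjoint blocks of variables\<close>

definition zprod :: "nat set \<Rightarrow> ratfun" where
  "zprod X = (\<Prod>j\<in>X. Z j)"

lemma zprod_empty [simp]: "zprod {} = 1" and zprod_single [simp]: "zprod {i} = Z i"
  by (simp_all add: zprod_def)

lemma zprod_Un_disjoint:
  "finite X \<Longrightarrow> finite Y \<Longrightarrow> X \<inter> Y = {} \<Longrightarrow> zprod (X \<union> Y) = zprod X * zprod Y"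
  by (simp add: zprod_def prod.union_disjoint)

lemma RatFun_zprod [simp]: "X \<subseteq> {1..n} \<Longrightarrow> zprod X \<in> RatFun n"
  by (auto simp: zprod_def intro!: RatFun_prod RatFun_Z)

lemma zprod_to_fract:
  "zprod X = to_fract (\<Prod>j\<in>X. Poly_Mapping.single (Poly_Mapping.single j 1) 1)"
  by (simp add: zprod_def Z_def to_fract_prod)

text \<open>
  Setting all variables to \<open>0\<close> gives \<open>-1\<close>. The lemma permits division by these functions, the
  factors of the denominators of the \<open>M\<^sub>u\<close>.
\<close>

lemma zprod_neq_1:
  assumes "finite X" "X \<noteq> {}"
  shows "zprod X - 1 \<noteq> 0"
proof
  assume "zprod X - 1 = 0"
  then have "rf_subst (\<lambda>_. 0) (zprod X) = 1" by simp
  moreover have "rf_subst (\<lambda>_. 0) (zprod X) = (\<Prod>j\<in>X. 0)"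
    unfolding zprod_to_fract rf_subst_to_fract poly_subst_prod poly_subst_var ..
  ultimately show False using assms by (auto simp: power_0_left split: if_splits)
qed

text \<open>
  Nonemptiness of the blocks is essential for independence: an empty block would send its variable
  to \<open>1\<close>.
\<close>

definition disjoint_blocks :: "nat \<Rightarrow> nat \<Rightarrow> (nat \<Rightarrow> nat set) \<Rightarrow> bool" where
  "disjoint_blocks n N e \<longleftrightarrow>
     disjoint_family_on e {1..n} \<and> (\<forall>i\<in>{1..n}. e i \<noteq> {} \<and> e i \<subseteq> {1..N})"

abbreviation block_subst :: "(nat \<Rightarrow> nat set) \<Rightarrow> ratfun \<Rightarrow> ratfun" where
  "block_subst e \<equiv> rf_subst (\<lambda>i. zprod (e i))"

lemma disjoint_blocks_finite: "disjoint_blocks n N e \<Longrightarrow> i \<in> {1..n} \<Longrightarrow> finite (e i)"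
  using finite_subset[of "e i" "{1..N}"] by (simp add: disjoint_blocks_def)

lemma disjoint_blocks_disjoint:
  "disjoint_blocks n N e \<Longrightarrow> i \<in> {1..n} \<Longrightarrow> j \<in> {1..n} \<Longrightarrow> i \<noteq> j \<Longrightarrow> e i \<inter> e j = {}"
  by (simp add: disjoint_blocks_def disjoint_family_on_def)

text \<open>
  Keep one variable of each block and set the others to \<open>1\<close>: this is a left inverse of the
  substitution.
\<close>

lemma alg_indep_blocks:
  assumes e: "disjoint_blocks n N e"
  shows "alg_indep n (\<lambda>i. zprod (e i))"
proof -
  define r where "r i = (SOME j. j \<in> e i)" for i
  have r: "r i \<in> e i" if "i \<in> {1..n}" for i
    unfolding r_def using e that by (auto simp: disjoint_blocks_def intro: some_in_eq[THEN iffD2])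
  have uniq: "i = i'" if "i \<in> {1..n}" "i' \<in> {1..n}" "j \<in> e i" "j \<in> e i'" for i i' j
    using disjoint_blocks_disjoint[OF e, of i i'] that by blast
  define \<tau> where "\<tau> j = (if j \<in> r ` {1..n} then Z (inv_into {1..n} r j) else 1)" for j
  have inj: "inj_on r {1..n}"
  proof (rule inj_onI)
    fix a b assume "a \<in> {1..n}" "b \<in> {1..n}" "r a = r b"
    then show "a = b" using uniq[of a b "r a"] r[of a] r[of b] by simp
  qed
  have \<tau>: "\<tau> j = (if j = r i then Z i else 1)" if ij: "i \<in> {1..n}" "j \<in> e i" for i j
  proof (cases "j \<in> r ` {1..n}")
    case True
    then obtain i' where i': "i' \<in> {1..n}" "j = r i'" by blast
    then have "i' = i" using uniq[of i' i j] r[of i'] ij by simp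
    with i' inj show ?thesis by (simp add: \<tau>_def inv_into_f_f)
  next
    case False
    with ij show ?thesis by (auto simp: \<tau>_def)
  qed
  have "alg_indep n (\<lambda>i. to_fract (\<Prod>j\<in>e i. Poly_Mapping.single (Poly_Mapping.single j 1) 1))"
  proof (rule alg_indep_left_inverse[where \<tau> = \<tau>])
    fix i assume i: "i \<in> {1..n}"
    have "(\<Prod>j\<in>e i. \<tau> j) = (\<Prod>j\<in>e i. if j = r i then Z i else 1)"
      using \<tau>[OF i] by (intro prod.cong) auto
    also have "\<dots> = Z i"
      using r[OF i] disjoint_blocks_finite[OF e i] by simp
    finally show "poly_subst \<tau> (\<Prod>j\<in>e i. Poly_Mapping.single (Poly_Mapping.single j 1) 1) = Z i"
      by (simp only: poly_subst_prod poly_subst_var)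
  qed
  then show ?thesis by (simp only: zprod_to_fract)
qed

lemma zprod_block_in_RatFun:
  "disjoint_blocks n N e \<Longrightarrow> i \<in> {1..n} \<Longrightarrow> zprod (e i) \<in> RatFun N"
  by (auto simp: disjoint_blocks_def)

lemma block_subst_in_RatFun:
  "disjoint_blocks n N e \<Longrightarrow> r \<in> RatFun n \<Longrightarrow> block_subst e r \<in> RatFun N"
  by (rule rf_subst_in_RatFun[OF alg_indep_blocks]) (auto simp: zprod_block_in_RatFun)

lemma block_subst_zprod:
  assumes e: "disjoint_blocks n N e" and X: "X \<subseteq> {1..n}"
  shows "block_subst e (zprod X) = zprod (\<Union>i\<in>X. e i)"
proof -
  have "block_subst e (zprod X) = (\<Prod>i\<in>X. zprod (e i))"
    unfolding zprod_def[of X] using X by (subst rf_subst_prod[OF alg_indep_blocks[OF e]]) auto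
  also have "\<dots> = zprod (\<Union>i\<in>X. e i)"
    unfolding zprod_def
  proof (rule prod.UNION_disjoint[symmetric])
    show "finite X" using X by (rule finite_subset) simp
    show "\<forall>i\<in>X. finite (e i)" using X disjoint_blocks_finite[OF e] by blast
    show "\<forall>i\<in>X. \<forall>j\<in>X. i \<noteq> j \<longrightarrow> e i \<inter> e j = {}"
      using disjoint_blocks_disjoint[OF e] X by (metis subsetD)
  qed
  finally show ?thesis .
qed

lemma block_subst_zprod_diff_1:
  assumes e: "disjoint_blocks n N e" and X: "X \<subseteq> {1..n}"
  shows "block_subst e (zprod X - 1) = zprod (\<Union>i\<in>X. e i) - 1"
  using X by (simp add: rf_subst_diff[OF alg_indep_blocks[OF e]] block_subst_zprod[OF e])

lemma block_subst_comp:
  assumes "disjoint_blocks n N d" "disjoint_blocks N M e" "r \<in> RatFun n"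
    and c: "\<And>i. i \<in> {1..n} \<Longrightarrow> (\<Union>j\<in>d i. e j) = c i"
  shows "block_subst e (block_subst d r) = block_subst c r"
proof -
  let ?ed = "\<lambda>i. block_subst e (zprod (d i))"
  have "block_subst e (block_subst d r) = rf_subst ?ed r"
    using assms by (intro rf_subst_comp[where n = n and N = N]) (auto simp: alg_indep_blocks zprod_block_in_RatFun)
  also have "\<dots> = block_subst c r"
  proof (rule rf_subst_cong)
    show "alg_indep n ?ed"
      using assms by (intro alg_indep_comp[where N = N]) (auto simp: alg_indep_blocks zprod_block_in_RatFun)
    show "?ed i = zprod (c i)" if "i \<in> {1..n}" for i
      using that block_subst_zprod[OF assms(2), of "d i"] assms(1) c[OF that]
      by (auto simp: disjoint_blocks_def)
  qed fact
  finally show ?thesis .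
qed

section \<open>The mould operad\<close>

text \<open>
  The monotone surjection that squeezes \<open>{k..k + n - 1}\<close> to \<open>k\<close> and closes the gap. Describing
  the blocks of \<open>\<circ>\<^sub>k\<close> as its fibres makes their disjointness automatic, and unions of blocks
  become preimages.
\<close>

definition collapse :: "nat \<Rightarrow> nat \<Rightarrow> nat \<Rightarrow> nat" where
  "collapse k n j = (if j < k then j else if j < k + n then k else j + 1 - n)"

definition ins :: "nat \<Rightarrow> nat \<Rightarrow> nat \<Rightarrow> nat set" where
  "ins k n i = {j. collapse k n j = i}"

text \<open>
  Singletons, so that the renaming applied to the second argument of \<open>\<circ>\<^sub>k\<close> is a block substitution too.
\<close>

definition shift :: "nat \<Rightarrow> nat \<Rightarrow> nat set" where
  "shift k i = {j. j + 1 = k + i}"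

lemma UN_ins: "(\<Union>i\<in>X. ins k n i) = {j. collapse k n j \<in> X}"
  by (auto simp: ins_def)

lemma ins_eq:
  assumes "n \<ge> 1"
  shows "ins k n i = (if i < k then {i} else if i = k then {k..k + n - 1} else {i + n - 1})"
  using assms by (auto simp: ins_def collapse_def split: if_splits)

lemma shift_eq: "k \<ge> 1 \<Longrightarrow> shift k i = {k + i - 1}"
  by (auto simp: shift_def)

lemma disjoint_blocks_ins:
  assumes "n \<ge> 1" "k \<in> {1..m}"
  shows "disjoint_blocks m (m + n - 1) (ins k n)"
proof -
  have "disjoint_family_on (ins k n) {1..m}"
    by (auto simp: disjoint_family_on_def ins_def)
  then show ?thesis using assms
    by (auto simp: disjoint_blocks_def ins_eq split: if_splits)
qed

lemma disjoint_blocks_shift: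
  assumes "k \<in> {1..m}"
  shows "disjoint_blocks n (m + n - 1) (shift k)"
  using assms by (auto simp: disjoint_blocks_def disjoint_family_on_def shift_eq)

lemma mould_pc_blocks:
  assumes "n \<ge> 1" "k \<ge> 1"
  shows "mould_pc m n k P Q =
    (zprod {k..k + n - 1} - 1) * block_subst (ins k n) P * block_subst (shift k) Q"
proof -
  have "(\<lambda>i. if i < k then Z i else if i = k then (\<Prod>j\<in>{k..k+n-1}. Z j) else Z (i + n - 1))
      = (\<lambda>i. zprod (ins k n i))"
    using assms by (auto simp: ins_eq zprod_def)
  moreover have "(\<lambda>i. Z (k + i - 1)) = (\<lambda>i. zprod (shift k i))"
    using assms by (simp add: shift_eq)
  ultimately show ?thesis
    by (simp add: mould_pc_def zprod_def)
qed

text \<open>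
  Applying a block substitution to a composite only changes the three set-valued data of the
  composite. Both sides of either associativity axiom are instances, so they can be compared set by set.
\<close>

lemma block_subst_mould_pc:
  assumes k: "k \<in> {1..m}" "n \<ge> 1" and e: "disjoint_blocks (m + n - 1) N e"
    and P: "P \<in> RatFun m" and Q: "Q \<in> RatFun n"
    and X: "(\<Union>j\<in>{k..k + n - 1}. e j) = X"
    and c: "\<And>i. i \<in> {1..m} \<Longrightarrow> (\<Union>j\<in>ins k n i. e j) = c i"
    and d: "\<And>i. i \<in> {1..n} \<Longrightarrow> (\<Union>j\<in>shift k i. e j) = d i"
  shows "block_subst e (mould_pc m n k P Q) = (zprod X - 1) * block_subst c P * block_subst d Q"
proof -
  have sub: "{k..k + n - 1} \<subseteq> {1..m + n - 1}" using k by auto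
  have "block_subst (ins k n) P \<in> RatFun (m + n - 1)" "block_subst (shift k) Q \<in> RatFun (m + n - 1)"
    using block_subst_in_RatFun[OF disjoint_blocks_ins[OF k(2,1)] P]
      block_subst_in_RatFun[OF disjoint_blocks_shift[OF k(1)] Q] by simp_all
  then have "block_subst e (mould_pc m n k P Q) =
      block_subst e (zprod {k..k + n - 1} - 1) * block_subst e (block_subst (ins k n) P)
        * block_subst e (block_subst (shift k) Q)"
    using k sub by (simp add: mould_pc_blocks rf_subst_mult[OF alg_indep_blocks[OF e]])
  also have "\<dots> = (zprod X - 1) * block_subst c P * block_subst d Q"
    using block_subst_zprod_diff_1[OF e sub] X
      block_subst_comp[OF disjoint_blocks_ins[OF k(2,1)] e P c]
      block_subst_comp[OF disjoint_blocks_shift[OF k(1)] e Q d]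
    by simp
  finally show ?thesis .
qed

lemma UN_shift: "0 \<notin> X \<Longrightarrow> (\<Union>j\<in>X. shift k j) = {b. b + 1 - k \<in> X}"
proof (intro set_eqI iffI)
  fix b assume "0 \<notin> X" "b \<in> {b. b + 1 - k \<in> X}"
  then show "b \<in> (\<Union>j\<in>X. shift k j)"
    by (intro UN_I[of "b + 1 - k"]) (auto simp: shift_def intro!: le_add_diff_inverse[symmetric] intro: ccontr)
qed (auto simp: shift_def)

text \<open>
  Squeezing an interval inside \<open>{i..}\<close> and then the image of the larger interval is the same as
  squeezing the larger interval at once.
\<close>

lemma collapse_nested:
  "1 \<le> i \<Longrightarrow> j \<in> {1..m} \<Longrightarrow> n \<ge> 1 \<Longrightarrow>
   collapse i m (collapse (i + j - 1) n b) = collapse i (m + n - 1) b"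
  unfolding collapse_def by auto

text \<open>
  Squeezing two disjoint intervals, in either order; the interval on the right has moved when the
  one on the left is squeezed first.
\<close>

lemma collapse_disjoint:
  "1 \<le> i \<Longrightarrow> i < k \<Longrightarrow> m \<ge> 1 \<Longrightarrow> n \<ge> 1 \<Longrightarrow>
   collapse i m (collapse (k + m - 1) n b) = collapse k n (collapse i m b)"
  unfolding collapse_def by auto

lemma collapse_shift:
  "i \<ge> 1 \<Longrightarrow> j \<ge> 1 \<Longrightarrow> a \<ge> 1 \<Longrightarrow> n \<ge> 1 \<Longrightarrow>
   collapse j n (b + 1 - i) = a \<longleftrightarrow> collapse (i + j - 1) n b + 1 = i + a"
  unfolding collapse_def by auto

lemma collapse_eq_below: "n \<ge> 1 \<Longrightarrow> a < k \<Longrightarrow> collapse k n b = a \<longleftrightarrow> b = a"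
  unfolding collapse_def by auto

lemma collapse_eq_above: "n \<ge> 1 \<Longrightarrow> k < a \<Longrightarrow> collapse k n b = a \<longleftrightarrow> b = a + n - 1"
  unfolding collapse_def by auto

lemma collapse_vimage_interval:
  "n \<ge> 1 \<Longrightarrow> i \<le> k \<Longrightarrow> k < i + m \<Longrightarrow>
   {b. collapse k n b \<in> {i..i + m - 1}} = {i..i + (m + n - 1) - 1}"
  unfolding collapse_def by auto

lemma collapse_vimage_interval_below:
  "n \<ge> 1 \<Longrightarrow> i + m \<le> k \<Longrightarrow> m \<ge> 1 \<Longrightarrow> {b. collapse k n b \<in> {i..i + m - 1}} = {i..i + m - 1}"
  unfolding collapse_def by auto

lemma collapse_vimage_interval_above:
  "m \<ge> 1 \<Longrightarrow> i < k \<Longrightarrow> {b. collapse i m b \<in> {k..k + n - 1}} = {k + m - 1..k + m - 1 + n - 1}"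
  unfolding collapse_def by auto

lemma mould_sequential:
  assumes pos: "l \<ge> 1" "m \<ge> 1" "n \<ge> 1" and i: "i \<in> {1..l}" and j: "j \<in> {1..m}"
    and x: "x \<in> RatFun l" and y: "y \<in> RatFun m" and z: "z \<in> RatFun n"
  shows "mould_pc (l + m - 1) n (i + j - 1) (mould_pc l m i x y) z =
    mould_pc l (m + n - 1) i x (mould_pc m n j y z)"
proof -
  \<comment> \<open>The block that replaces the variable \<open>a\<close> of the middle factor \<open>y\<close>, in either bracketing.\<close>
  define d where "d a = {b. collapse (i + j - 1) n b + 1 = i + a}" for a
  have ij: "i + j - 1 \<in> {1..l + m - 1}" using i j by auto
  have "block_subst (ins (i + j - 1) n) (mould_pc l m i x y)
      = (zprod {i..i + (m + n - 1) - 1} - 1) * block_subst (ins i (m + n - 1)) x * block_subst d y"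
  proof (rule block_subst_mould_pc[OF i pos(2) disjoint_blocks_ins[OF pos(3) ij] x y])
    show "(\<Union>b\<in>{i..i + m - 1}. ins (i + j - 1) n b) = {i..i + (m + n - 1) - 1}"
      unfolding UN_ins by (rule collapse_vimage_interval) (use pos j in auto)
    show "(\<Union>b\<in>ins i m a. ins (i + j - 1) n b) = ins i (m + n - 1) a" for a
      unfolding UN_ins using collapse_nested[of i j m n] i j pos by (simp add: ins_def)
    show "(\<Union>b\<in>shift i a. ins (i + j - 1) n b) = d a" for a
      unfolding UN_ins by (simp add: shift_def d_def)
  qed
  moreover have "block_subst (shift i) (mould_pc m n j y z)
      = (zprod {i + j - 1..i + j - 1 + n - 1} - 1) * block_subst d y * block_subst (shift (i + j - 1)) z"
  proof (rule block_subst_mould_pc[OF j pos(3) _ y z])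
    show "disjoint_blocks (m + n - 1) (l + (m + n - 1) - 1) (shift i)"
      using i by (rule disjoint_blocks_shift)
    show "(\<Union>c\<in>{j..j + n - 1}. shift i c) = {i + j - 1..i + j - 1 + n - 1}"
      using i j by (subst UN_shift) auto
    show "(\<Union>c\<in>ins j n a. shift i c) = d a" if "a \<in> {1..m}" for a
    proof -
      have "0 \<notin> ins j n a" using that j by (auto simp: ins_def collapse_def)
      moreover have "b + 1 - i \<in> ins j n a \<longleftrightarrow> b \<in> d a" for b
        unfolding ins_def d_def mem_Collect_eq by (rule collapse_shift) (use that i j pos in auto)
      ultimately show ?thesis
        using UN_shift[of "ins j n a" i] by blast
    qed
    show "(\<Union>c\<in>shift j a. shift i c) = shift (i + j - 1) a" for a
      using i j by (auto simp: shift_eq)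
  qed
  moreover have "mould_pc (l + m - 1) n (i + j - 1) (mould_pc l m i x y) z
      = (zprod {i + j - 1..i + j - 1 + n - 1} - 1) * block_subst (ins (i + j - 1) n) (mould_pc l m i x y)
        * block_subst (shift (i + j - 1)) z"
    using pos(3) ij by (intro mould_pc_blocks) auto
  moreover have "mould_pc l (m + n - 1) i x (mould_pc m n j y z)
      = (zprod {i..i + (m + n - 1) - 1} - 1) * block_subst (ins i (m + n - 1)) x
        * block_subst (shift i) (mould_pc m n j y z)"
    using pos i by (intro mould_pc_blocks) auto
  ultimately show ?thesis
    by (simp only: mult_ac)
qed

lemma mould_parallel:
  assumes pos: "l \<ge> 1" "m \<ge> 1" "n \<ge> 1" and ik: "1 \<le> i" "i < k" "k \<le> l"
    and x: "x \<in> RatFun l" and y: "y \<in> RatFun m" and z: "z \<in> RatFun n"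
  shows "mould_pc (l + m - 1) n (k + m - 1) (mould_pc l m i x y) z =
    mould_pc (l + n - 1) m i (mould_pc l n k x z) y"
proof -
  \<comment> \<open>The block that replaces the variable \<open>a\<close> of \<open>x\<close>, in either order of composition.\<close>
  define d where "d a = {b. collapse i m (collapse (k + m - 1) n b) = a}" for a
  have i: "i \<in> {1..l}" and k: "k \<in> {1..l}" and km: "k + m - 1 \<in> {1..l + m - 1}"
    and i': "i \<in> {1..l + n - 1}" using ik pos by auto
  have "block_subst (ins (k + m - 1) n) (mould_pc l m i x y)
      = (zprod {i..i + m - 1} - 1) * block_subst d x * block_subst (shift i) y"
  proof (rule block_subst_mould_pc[OF i pos(2) disjoint_blocks_ins[OF pos(3) km] x y])
    show "(\<Union>b\<in>{i..i + m - 1}. ins (k + m - 1) n b) = {i..i + m - 1}"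
      unfolding UN_ins by (rule collapse_vimage_interval_below) (use pos ik in auto)
    show "(\<Union>b\<in>ins i m a. ins (k + m - 1) n b) = d a" for a
      unfolding UN_ins by (simp add: ins_def d_def)
    show "(\<Union>b\<in>shift i a. ins (k + m - 1) n b) = shift i a" if "a \<in> {1..m}" for a
    proof -
      have "i + a - 1 < k + m - 1" using that ik by auto
      then show ?thesis
        using ik collapse_eq_below[OF pos(3)] unfolding UN_ins by (simp add: shift_eq)
    qed
  qed
  moreover have "block_subst (ins i m) (mould_pc l n k x z)
      = (zprod {k + m - 1..k + m - 1 + n - 1} - 1) * block_subst d x * block_subst (shift (k + m - 1)) z"
  proof (rule block_subst_mould_pc[OF k pos(3) disjoint_blocks_ins[OF pos(2) i'] x z])
    show "(\<Union>b\<in>{k..k + n - 1}. ins i m b) = {k + m - 1..k + m - 1 + n - 1}"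
      unfolding UN_ins by (rule collapse_vimage_interval_above) (use pos ik in auto)
    show "(\<Union>b\<in>ins k n a. ins i m b) = d a" for a
      unfolding UN_ins using collapse_disjoint[of i k m n] ik pos by (simp add: ins_def d_def)
    show "(\<Union>b\<in>shift k a. ins i m b) = shift (k + m - 1) a" if "a \<in> {1..n}" for a
    proof -
      have "i < k + a - 1" "k + a - 1 + m - 1 = k + m - 1 + a - 1" using that ik pos by auto
      then show ?thesis
        using ik pos collapse_eq_above[OF pos(2), of i "k + a - 1"]
        unfolding UN_ins by (simp add: shift_eq)
    qed
  qed
  ultimately show ?thesis
    using pos ik by (simp add: mould_pc_blocks mult_ac)
qed

text \<open>
  On the left, the substitution turns the unit into \<open>1 / (z\<^sub>1 \<dots> z\<^sub>n - 1)\<close>, on the right into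
  \<open>1 / (z\<^sub>k - 1)\<close>; either way it cancels the extra factor of the composition.
\<close>

lemma mould_unit: "is_operad_unit RatFun mould_pc (inverse (Z 1 - 1))"
proof -
  have Z1: "Z k - 1 \<noteq> 0" for k
    using zprod_neq_1[of "{k}"] by simp
  have "mould_pc 1 n 1 (inverse (Z 1 - 1)) x = x" if "n \<ge> 1" "x \<in> RatFun n" for n x
  proof -
    have e: "disjoint_blocks 1 n (ins 1 n)"
      using disjoint_blocks_ins[of n 1 1] that by simp
    have "block_subst (ins 1 n) (inverse (Z 1 - 1)) = inverse (block_subst (ins 1 n) (zprod {1} - 1))"
      using rf_subst_inverse[OF alg_indep_blocks[OF e], of "Z 1 - 1"] by simp
    also have "block_subst (ins 1 n) (zprod {1} - 1) = zprod {1..n} - 1"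
      using block_subst_zprod_diff_1[OF e, of "{1}"] that by (simp add: ins_eq)
    finally have "block_subst (ins 1 n) (inverse (Z 1 - 1)) = inverse (zprod {1..n} - 1)" .
    moreover have "block_subst (shift 1) x = x"
      by (rule rf_subst_ident[OF that(2)]) (simp add: shift_eq)
    ultimately show ?thesis
      using zprod_neq_1[of "{1..n}"] that by (simp add: mould_pc_blocks)
  qed
  moreover have "mould_pc n 1 k x (inverse (Z 1 - 1)) = x" if "k \<in> {1..n}" "x \<in> RatFun n" for n k x
  proof -
    have e: "disjoint_blocks 1 n (shift k)"
      using disjoint_blocks_shift[of k n 1] that by simp
    have "block_subst (shift k) (inverse (Z 1 - 1)) = inverse (block_subst (shift k) (zprod {1} - 1))"
      using rf_subst_inverse[OF alg_indep_blocks[OF e], of "Z 1 - 1"] by simp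
    also have "block_subst (shift k) (zprod {1} - 1) = Z k - 1"
      using block_subst_zprod_diff_1[OF e, of "{1}"] that by (simp add: shift_eq)
    finally have "block_subst (shift k) (inverse (Z 1 - 1)) = inverse (Z k - 1)" .
    moreover have "block_subst (ins k 1) x = x"
      by (rule rf_subst_ident[OF that(2)]) (simp add: ins_eq)
    ultimately show ?thesis
      using Z1[of k] that by (simp add: mould_pc_blocks)
  qed
  ultimately show ?thesis
    by (auto simp: is_operad_unit_def)
qed

lemma mould_pc_in_RatFun:
  assumes n: "n \<ge> 1" and k: "k \<in> {1..m}" and P: "P \<in> RatFun m" and Q: "Q \<in> RatFun n"
  shows "mould_pc m n k P Q \<in> RatFun (m + n - 1)"
proof -
  have "mould_pc m n k P Q =
      (zprod {k..k + n - 1} - 1) * block_subst (ins k n) P * block_subst (shift k) Q"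
    using n k by (intro mould_pc_blocks) auto
  moreover have "{k..k + n - 1} \<subseteq> {1..m + n - 1}"
    using n k by auto
  ultimately show ?thesis
    using block_subst_in_RatFun[OF disjoint_blocks_ins[OF n k] P]
      block_subst_in_RatFun[OF disjoint_blocks_shift[OF k] Q]
    by (simp only: RatFun_mult RatFun_diff RatFun_zprod RatFun_1)
qed

lemma mould_pc_bilinear:
  assumes n: "n \<ge> 1" and k: "k \<in> {1..m}" and P: "P \<in> RatFun m" "P' \<in> RatFun m"
    and Q: "Q \<in> RatFun n" "Q' \<in> RatFun n"
  shows "mould_pc m n k (P + P') Q = mould_pc m n k P Q + mould_pc m n k P' Q"
    "mould_pc m n k (rf_scale c P) Q = rf_scale c (mould_pc m n k P Q)"
    "mould_pc m n k P (Q + Q') = mould_pc m n k P Q + mould_pc m n k P Q'"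
    "mould_pc m n k P (rf_scale c Q) = rf_scale c (mould_pc m n k P Q)"
proof -
  have pc: "mould_pc m n k P Q =
      (zprod {k..k + n - 1} - 1) * block_subst (ins k n) P * block_subst (shift k) Q" for P Q
    using n k by (intro mould_pc_blocks) auto
  note ins = alg_indep_blocks[OF disjoint_blocks_ins[OF n k]]
    and shift = alg_indep_blocks[OF disjoint_blocks_shift[OF k, of n]]
  show "mould_pc m n k (P + P') Q = mould_pc m n k P Q + mould_pc m n k P' Q"
    unfolding pc rf_subst_add[OF ins P] by (simp only: distrib_left distrib_right)
  show "mould_pc m n k (rf_scale c P) Q = rf_scale c (mould_pc m n k P Q)"
    unfolding pc rf_subst_scale[OF ins P(1)] by (simp only: rf_scale_def mult_ac)
  show "mould_pc m n k P (Q + Q') = mould_pc m n k P Q + mould_pc m n k P Q'"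
    unfolding pc rf_subst_add[OF shift Q] by (simp only: distrib_left distrib_right)
  show "mould_pc m n k P (rf_scale c Q) = rf_scale c (mould_pc m n k P Q)"
    unfolding pc rf_subst_scale[OF shift Q(1)] by (simp only: rf_scale_def mult_ac)
qed

theorem mould_operad: "ns_operad rf_scale RatFun mould_pc"
proof (unfold_locales, goal_cases)
  case 1 show ?case by (rule subspace_RatFun)
next
  case 2 then show ?case by (intro mould_pc_in_RatFun)
next
  case 3 then show ?case by (intro mould_pc_bilinear)
next
  case 4 then show ?case by (intro mould_pc_bilinear)
next
  case 5 then show ?case by (intro mould_pc_bilinear)
next
  case 6 then show ?case by (intro mould_pc_bilinear)
next
  case 7 then show ?case by (intro mould_sequential)
next
  case 8 then show ?case by (intro mould_parallel)
next
  case 9 show ?case using mould_unit by blast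
qed

section \<open>Transport of operad structures\<close>

text \<open>
  Linear bijections that intertwine an operad structure with a family of maps \<open>pc'\<close> carry all
  operad axioms over to \<open>pc'\<close>: both sides of an axiom for \<open>pc'\<close> are the images under \<open>\<phi>\<close> of the two sides
  of the same axiom for \<open>pc\<close>.
\<close>

lemma operad_transport:
  assumes op: "ns_operad scale Op pc" and vs: "vector_space scale'"
    and bij: "\<And>n. n \<ge> 1 \<Longrightarrow> bij_betw (\<phi> n) (Op n) (Op' n)"
    and add: "\<And>n x y. n \<ge> 1 \<Longrightarrow> x \<in> Op n \<Longrightarrow> y \<in> Op n \<Longrightarrow> \<phi> n (x + y) = \<phi> n x + \<phi> n y"
    and scale: "\<And>n c x. n \<ge> 1 \<Longrightarrow> x \<in> Op n \<Longrightarrow> \<phi> n (scale c x) = scale' c (\<phi> n x)"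
    and pc: "\<And>m n k x y. m \<ge> 1 \<Longrightarrow> n \<ge> 1 \<Longrightarrow> k \<in> {1..m} \<Longrightarrow> x \<in> Op m \<Longrightarrow> y \<in> Op n \<Longrightarrow>
      \<phi> (m + n - 1) (pc m n k x y) = pc' m n k (\<phi> m x) (\<phi> n y)"
  shows "is_operad_iso scale Op pc scale' Op' pc' \<phi>"
proof -
  interpret op: ns_operad scale Op pc by (fact op)
  interpret vs: vector_space scale' by (fact vs)
  have Op'_eq: "Op' n = \<phi> n ` Op n" if "n \<ge> 1" for n
    using bij[OF that] by (simp add: bij_betw_def)
  have Op'_E: "\<exists>x\<in>Op n. x' = \<phi> n x" if "n \<ge> 1" "x' \<in> Op' n" for n x'
    using that Op'_eq by auto
  have Op_add: "x + y \<in> Op n" and Op_scale: "scale c x \<in> Op n" and Op_0: "0 \<in> Op n"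
    if "n \<ge> 1" "x \<in> Op n" "y \<in> Op n" for n x y c
    using op.subspace_Op[OF that(1)] that(2,3) by (auto intro: op.subspace_add op.subspace_scale op.subspace_0)
  have in_Op': "\<phi> n x \<in> Op' n" if "n \<ge> 1" "x \<in> Op n" for n x
    using that Op'_eq by auto
  have unit: "is_operad_unit Op' pc' (\<phi> 1 e)" if "is_operad_unit Op pc e" for e
    unfolding is_operad_unit_def
  proof (intro conjI allI impI ballI)
    have e: "e \<in> Op 1" using that by (simp add: is_operad_unit_def)
    then show "\<phi> 1 e \<in> Op' 1" by (simp add: in_Op')
    fix n x' assume n: "1 \<le> n" "x' \<in> Op' n"
    then obtain x where x: "x \<in> Op n" "x' = \<phi> n x" using Op'_E by blast
    show "pc' 1 n 1 (\<phi> 1 e) x' = x'"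
      using pc[of 1 n 1 e x] that e x n by (simp add: is_operad_unit_def)
    fix k assume "k \<in> {1..n}"
    then show "pc' n 1 k x' (\<phi> 1 e) = x'"
      using pc[of n 1 k x e] that e x n by (simp add: is_operad_unit_def)
  qed
  have "ns_operad scale' Op' pc'"
  proof
    show "vs.subspace (Op' n)" if n: "n \<ge> 1" for n
    proof (rule vs.subspaceI)
      have "0 \<in> Op n" using op.subspace_Op[OF n] by (rule op.subspace_0)
      moreover from this have "\<phi> n 0 = 0" using scale[of n 0 0] n by simp
      ultimately show "0 \<in> Op' n" using in_Op'[OF n, of 0] by simp
    qed (use n add[OF n, symmetric] scale[OF n, symmetric] Op'_eq Op_add Op_scale in fastforce)+
  next
    fix m n k x' y' assume *: "m \<ge> 1" "n \<ge> 1" "k \<in> {1..m}" "x' \<in> Op' m" "y' \<in> Op' n"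
    then obtain x y where xy: "x \<in> Op m" "x' = \<phi> m x" "y \<in> Op n" "y' = \<phi> n y"
      using Op'_E by meson
    have mn: "m + n - 1 \<ge> 1" using *(1,2) by linarith
    note closed = op.pc_closed[OF *(1-3)] and \<phi>_pc = pc[OF *(1-3)]
    show "pc' m n k x' y' \<in> Op' (m + n - 1)"
      unfolding xy(2,4) \<phi>_pc[OF xy(1,3), symmetric] by (rule in_Op'[OF mn closed[OF xy(1,3)]])
    show "pc' m n k (scale' c x') y' = scale' c (pc' m n k x' y')" for c
    proof -
      have "pc' m n k (scale' c x') y' = \<phi> (m + n - 1) (pc m n k (scale c x) y)"
        by (simp only: xy(2,4) scale[OF *(1) xy(1)] \<phi>_pc[OF Op_scale[OF *(1) xy(1) xy(1)] xy(3)])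
      also have "\<dots> = scale' c (pc' m n k x' y')"
        by (simp only: op.pc_scale_left[OF *(1-3) xy(1,3)] scale[OF mn closed[OF xy(1,3)]] \<phi>_pc[OF xy(1,3)] xy(2,4))
      finally show ?thesis .
    qed
    show "pc' m n k x' (scale' c y') = scale' c (pc' m n k x' y')" for c
    proof -
      have "pc' m n k x' (scale' c y') = \<phi> (m + n - 1) (pc m n k x (scale c y))"
        by (simp only: xy(2,4) scale[OF *(2) xy(3)] \<phi>_pc[OF xy(1) Op_scale[OF *(2) xy(3) xy(3)]])
      also have "\<dots> = scale' c (pc' m n k x' y')"
        by (simp only: op.pc_scale_right[OF *(1-3) xy(1,3)] scale[OF mn closed[OF xy(1,3)]] \<phi>_pc[OF xy(1,3)] xy(2,4))
      finally show ?thesis .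
    qed
    show "pc' m n k (x' + u') y' = pc' m n k x' y' + pc' m n k u' y'" if u': "u' \<in> Op' m" for u'
    proof -
      obtain u where u: "u \<in> Op m" "u' = \<phi> m u" using Op'_E[OF _ u'] * by blast
      have "pc' m n k (x' + u') y' = \<phi> (m + n - 1) (pc m n k (x + u) y)"
        by (simp only: xy(2,4) u(2) add[OF *(1) xy(1) u(1)] \<phi>_pc[OF Op_add[OF *(1) xy(1) u(1)] xy(3)])
      also have "\<dots> = pc' m n k x' y' + pc' m n k u' y'"
        by (simp only: op.pc_add_left[OF *(1-3) xy(1) u(1) xy(3)] add[OF mn closed[OF xy(1,3)] closed[OF u(1) xy(3)]]
            \<phi>_pc[OF xy(1,3)] \<phi>_pc[OF u(1) xy(3)] xy(2,4) u(2))
      finally show ?thesis .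
    qed
    show "pc' m n k x' (y' + u') = pc' m n k x' y' + pc' m n k x' u'" if u': "u' \<in> Op' n" for u'
    proof -
      obtain u where u: "u \<in> Op n" "u' = \<phi> n u" using Op'_E[OF _ u'] * by blast
      have "pc' m n k x' (y' + u') = \<phi> (m + n - 1) (pc m n k x (y + u))"
        by (simp only: xy(2,4) u(2) add[OF *(2) xy(3) u(1)] \<phi>_pc[OF xy(1) Op_add[OF *(2) xy(3) u(1)]])
      also have "\<dots> = pc' m n k x' y' + pc' m n k x' u'"
        by (simp only: op.pc_add_right[OF *(1-3) xy(1) xy(3) u(1)] add[OF mn closed[OF xy(1,3)] closed[OF xy(1) u(1)]]
            \<phi>_pc[OF xy(1,3)] \<phi>_pc[OF xy(1) u(1)] xy(2,4) u(2))
      finally show ?thesis .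
    qed
  next
    fix l m n i j x' y' z'
    assume *: "l \<ge> 1" "m \<ge> 1" "n \<ge> 1" "i \<in> {1..l}" "j \<in> {1..m}" "x' \<in> Op' l" "y' \<in> Op' m" "z' \<in> Op' n"
    then obtain x y z where x: "x \<in> Op l" "x' = \<phi> l x" and y: "y \<in> Op m" "y' = \<phi> m y"
      and z: "z \<in> Op n" "z' = \<phi> n z"
      using Op'_E by meson
    have ar: "l + m - 1 \<ge> 1" "m + n - 1 \<ge> 1" "i + j - 1 \<in> {1..l + m - 1}"
      "l + m - 1 + n - 1 = l + (m + n - 1) - 1" using *(1-5) by auto
    have "pc' (l + m - 1) n (i + j - 1) (pc' l m i x' y') z'
        = \<phi> (l + m - 1 + n - 1) (pc (l + m - 1) n (i + j - 1) (pc l m i x y) z)"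
      unfolding x(2) y(2) z(2)
      using pc[OF *(1,2,4) x(1) y(1)] pc[OF ar(1) *(3) ar(3) op.pc_closed[OF *(1,2,4) x(1) y(1)] z(1)]
      by (simp only:)
    also have "\<dots> = \<phi> (l + (m + n - 1) - 1) (pc l (m + n - 1) i x (pc m n j y z))"
      by (simp only: op.sequential[OF *(1-5) x(1) y(1) z(1)] ar(4))
    also have "\<dots> = pc' l (m + n - 1) i x' (pc' m n j y' z')"
      unfolding x(2) y(2) z(2)
      using pc[OF *(2,3,5) y(1) z(1)] pc[OF *(1) ar(2) *(4) x(1) op.pc_closed[OF *(2,3,5) y(1) z(1)]]
      by (simp only:)
    finally show "pc' (l + m - 1) n (i + j - 1) (pc' l m i x' y') z' = pc' l (m + n - 1) i x' (pc' m n j y' z')" .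
  next
    fix l m n i k x' y' z'
    assume *: "l \<ge> 1" "m \<ge> 1" "n \<ge> 1" "1 \<le> i" "i < k" "k \<le> l" "x' \<in> Op' l" "y' \<in> Op' m" "z' \<in> Op' n"
    then obtain x y z where x: "x \<in> Op l" "x' = \<phi> l x" and y: "y \<in> Op m" "y' = \<phi> m y"
      and z: "z \<in> Op n" "z' = \<phi> n z"
      using Op'_E by meson
    have ar: "l + m - 1 \<ge> 1" "l + n - 1 \<ge> 1" "k + m - 1 \<in> {1..l + m - 1}" "i \<in> {1..l + n - 1}"
      "i \<in> {1..l}" "k \<in> {1..l}" "l + m - 1 + n - 1 = l + n - 1 + m - 1" using *(1-6) by auto
    have "pc' (l + m - 1) n (k + m - 1) (pc' l m i x' y') z'
        = \<phi> (l + m - 1 + n - 1) (pc (l + m - 1) n (k + m - 1) (pc l m i x y) z)"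
      unfolding x(2) y(2) z(2)
      using pc[OF *(1,2) ar(5) x(1) y(1)] pc[OF ar(1) *(3) ar(3) op.pc_closed[OF *(1,2) ar(5) x(1) y(1)] z(1)]
      by (simp only:)
    also have "\<dots> = \<phi> (l + n - 1 + m - 1) (pc (l + n - 1) m i (pc l n k x z) y)"
      by (simp only: op.parallel[OF *(1-6) x(1) y(1) z(1)] ar(7))
    also have "\<dots> = pc' (l + n - 1) m i (pc' l n k x' z') y'"
      unfolding x(2) y(2) z(2)
      using pc[OF *(1,3) ar(6) x(1) z(1)] pc[OF ar(2) *(2) ar(4) op.pc_closed[OF *(1,3) ar(6) x(1) z(1)] y(1)]
      by (simp only:)
    finally show "pc' (l + m - 1) n (k + m - 1) (pc' l m i x' y') z' = pc' (l + n - 1) m i (pc' l n k x' z') y'" .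
  next
    show "\<exists>e. is_operad_unit Op' pc' e"
      using op.has_unit unit by blast
  qed
  then show ?thesis
    unfolding is_operad_iso_def using op bij add scale pc unit by blast
qed

section \<open>The isomorphism with the Loday operad\<close>

definition translate :: "complex \<Rightarrow> ratfun \<Rightarrow> ratfun" where
  "translate c = rf_subst (\<lambda>i. Z i + rf_const c)"

lemma alg_indep_translate: "alg_indep n (\<lambda>i. Z i + rf_const c)"
proof -
  define s :: "nat \<Rightarrow> cpoly" where
    "s i = Poly_Mapping.single (Poly_Mapping.single i 1) 1 + Poly_Mapping.single 0 c" for i
  have "alg_indep n (\<lambda>i. to_fract (s i))"
  proof (rule alg_indep_left_inverse)
    show "poly_subst (\<lambda>i. Z i - rf_const c) (s i) = Z i" for i
      unfolding s_def poly_subst_add poly_subst_var poly_subst_const by simp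
  qed
  moreover have "to_fract (s i) = Z i + rf_const c" for i
    by (simp only: s_def Z_def rf_const_def to_fract_add)
  ultimately show ?thesis by simp
qed

lemma translate_in_RatFun: "r \<in> RatFun n \<Longrightarrow> translate c r \<in> RatFun n"
  unfolding translate_def by (rule rf_subst_in_RatFun[OF alg_indep_translate]) auto

lemma translate_inverse:
  assumes r: "r \<in> RatFun n"
  shows "translate (- c) (translate c r) = r"
proof -
  have "translate (- c) (translate c r) = rf_subst (\<lambda>i. translate (- c) (Z i + rf_const c)) r"
    unfolding translate_def
    by (rule rf_subst_comp[where N = n, OF alg_indep_translate _ alg_indep_translate r]) auto
  also have "\<dots> = r"
  proof (rule rf_subst_ident[OF r])
    show "translate (- c) (Z i + rf_const c) = Z i" if "i \<in> {1..n}" for i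
    proof -
      have "translate (- c) (Z i + rf_const c) = translate (- c) (Z i) + translate (- c) (rf_const c)"
        unfolding translate_def using that by (intro rf_subst_add[OF alg_indep_translate[of n]]) auto
      then show ?thesis by (simp add: translate_def rf_const_uminus)
    qed
  qed
  finally show ?thesis .
qed

text \<open>
  Conjugation by \<open>z = x + 1\<close> turns \<open>z\<^sub>i \<mapsto> \<Prod>j\<in>e i. z\<^sub>j\<close> into
  \<open>x\<^sub>i \<mapsto> (\<Prod>j\<in>e i. (x\<^sub>j + 1)) - 1\<close>, the multiplicative formal group law. Writing the
  latter as a composite also yields its algebraic independence.
\<close>

lemma loday_subst_conjugate:
  assumes e: "disjoint_blocks n N e" and r: "r \<in> RatFun n"
  shows "rf_subst (\<lambda>i. (\<Prod>j\<in>e i. Z j + 1) - 1) (translate 1 r) = translate 1 (block_subst e r)"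
proof -
  let ?\<sigma> = "\<lambda>i. Z i + rf_const (- 1)"
  let ?\<tau> = "\<lambda>i. block_subst e (?\<sigma> i)"
  let ?\<rho> = "\<lambda>i. translate 1 (?\<tau> i)"
  have \<sigma>: "?\<sigma> i \<in> RatFun n" if "i \<in> {1..n}" for i
    using that by simp
  have \<tau>: "?\<tau> i \<in> RatFun N" if "i \<in> {1..n}" for i
    using that by (intro block_subst_in_RatFun[OF e] \<sigma>)
  have tr: "translate 1 r \<in> RatFun n"
    using r by (rule translate_in_RatFun)
  have indep: "alg_indep n ?\<tau>"
    by (rule alg_indep_comp[OF alg_indep_translate \<sigma> alg_indep_blocks[OF e]])
  have indep': "alg_indep n ?\<rho>"
    unfolding translate_def[of 1] by (rule alg_indep_comp[OF indep \<tau> alg_indep_translate])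
  have \<rho>: "?\<rho> i = (\<Prod>j\<in>e i. Z j + 1) - 1" if i: "i \<in> {1..n}" for i
  proof -
    have ei: "e i \<subseteq> {1..N}" using e i by (auto simp: disjoint_blocks_def)
    have "?\<tau> i = zprod (e i) - 1"
      using i by (simp add: rf_const_uminus rf_subst_diff[OF alg_indep_blocks[OF e]])
    moreover have "translate 1 (zprod (e i) - 1) = translate 1 (zprod (e i)) - 1"
      unfolding translate_def using ei by (subst rf_subst_diff[OF alg_indep_translate[of N]]) auto
    moreover have "translate 1 (zprod (e i)) = (\<Prod>j\<in>e i. Z j + 1)"
      unfolding zprod_def translate_def
      using ei by (subst rf_subst_prod[OF alg_indep_translate[of N]]) auto
    ultimately show ?thesis by simp
  qed
  have "translate 1 (block_subst e r) = translate 1 (block_subst e (translate (- 1) (translate 1 r)))"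
    using translate_inverse[OF r, of 1] by simp
  also have "block_subst e (translate (- 1) (translate 1 r)) = rf_subst ?\<tau> (translate 1 r)"
    unfolding translate_def[of "- 1"]
    by (rule rf_subst_comp[OF alg_indep_translate \<sigma> alg_indep_blocks[OF e] tr])
  also have "translate 1 (rf_subst ?\<tau> (translate 1 r)) = rf_subst ?\<rho> (translate 1 r)"
    unfolding translate_def[of 1]
    by (rule rf_subst_comp[OF indep \<tau> alg_indep_translate tr[unfolded translate_def]])
  also have "\<dots> = rf_subst (\<lambda>i. (\<Prod>j\<in>e i. Z j + 1) - 1) (translate 1 r)"
    by (rule rf_subst_cong[OF indep' tr \<rho>])
  finally show ?thesis ..
qed

lemma loday_pc_blocks:
  assumes "n \<ge> 1" "k \<ge> 1"
  shows "loday_pc m n k P Q =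
    rf_subst (\<lambda>i. (\<Prod>j\<in>ins k n i. Z j + 1) - 1) P * rf_subst (\<lambda>i. (\<Prod>j\<in>shift k i. Z j + 1) - 1) Q"
proof -
  have "(\<lambda>i. if i < k then Z i else if i = k then (\<Prod>j\<in>{k..k+n-1}. (Z j + 1)) - 1 else Z (i + n - 1))
      = (\<lambda>i. (\<Prod>j\<in>ins k n i. Z j + 1) - 1)"
    using assms by (auto simp: ins_eq)
  moreover have "(\<lambda>i. Z (k + i - 1)) = (\<lambda>i. (\<Prod>j\<in>shift k i. Z j + 1) - 1)"
    using assms by (simp add: shift_eq)
  ultimately show ?thesis
    by (simp add: loday_pc_def)
qed

text \<open>
  The factor \<open>z\<^sub>1 \<dots> z\<^sub>n - 1\<close> absorbs the one by which the two compositions differ.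
\<close>

definition mould_to_loday :: "nat \<Rightarrow> ratfun \<Rightarrow> ratfun" where
  "mould_to_loday n P = translate 1 ((zprod {1..n} - 1) * P)"

lemma bij_mould_to_loday:
  assumes "n \<ge> 1"
  shows "bij_betw (mould_to_loday n) (RatFun n) (RatFun n)"
proof -
  have nz: "zprod {1..n} - 1 \<noteq> 0"
    by (rule zprod_neq_1) (use assms in auto)
  show ?thesis
  proof (rule bij_betw_byWitness)
    show "\<forall>P\<in>RatFun n. inverse (zprod {1..n} - 1) * translate (- 1) (mould_to_loday n P) = P"
      using nz by (auto simp: mould_to_loday_def translate_inverse[where n = n] simp flip: mult.assoc)
    show "\<forall>P\<in>RatFun n. mould_to_loday n (inverse (zprod {1..n} - 1) * translate (- 1) P) = P"
      using nz translate_inverse[where n = n and c = "- 1"]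
      by (auto simp: mould_to_loday_def simp flip: mult.assoc)
  qed (auto simp: mould_to_loday_def intro!: translate_in_RatFun RatFun_mult)
qed

lemma mould_to_loday_pc:
  assumes n: "n \<ge> 1" and k: "k \<in> {1..m}" and P: "P \<in> RatFun m" and Q: "Q \<in> RatFun n"
  shows "mould_to_loday (m + n - 1) (mould_pc m n k P Q) =
    loday_pc m n k (mould_to_loday m P) (mould_to_loday n Q)"
proof -
  let ?N = "m + n - 1"
  let ?P = "(zprod {1..m} - 1) * P" and ?Q = "(zprod {1..n} - 1) * Q"
  have P': "?P \<in> RatFun m" and Q': "?Q \<in> RatFun n"
    using P Q by auto
  note ins = disjoint_blocks_ins[OF n k] and shift = disjoint_blocks_shift[OF k, of n]
  have "(\<Union>i\<in>{1..m}. ins k n i) = {1..?N}"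
    unfolding UN_ins using n k by (auto simp: collapse_def)
  then have insP: "block_subst (ins k n) ?P = (zprod {1..?N} - 1) * block_subst (ins k n) P"
    using P block_subst_zprod_diff_1[OF ins order.refl]
    by (simp add: rf_subst_mult[OF alg_indep_blocks[OF ins]])
  have "(\<Union>i\<in>{1..n}. shift k i) = {k..k + n - 1}"
    using n k by (subst UN_shift) auto
  then have shiftQ: "block_subst (shift k) ?Q = (zprod {k..k + n - 1} - 1) * block_subst (shift k) Q"
    using Q block_subst_zprod_diff_1[OF shift order.refl]
    by (simp add: rf_subst_mult[OF alg_indep_blocks[OF shift]])
  have pc: "mould_pc m n k P Q =
      (zprod {k..k + n - 1} - 1) * block_subst (ins k n) P * block_subst (shift k) Q"
    using n k by (intro mould_pc_blocks) auto
  have "loday_pc m n k (mould_to_loday m P) (mould_to_loday n Q)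
      = translate 1 (block_subst (ins k n) ?P) * translate 1 (block_subst (shift k) ?Q)"
    using n k unfolding mould_to_loday_def
    by (simp only: loday_pc_blocks atLeastAtMost_iff loday_subst_conjugate[OF ins P'] loday_subst_conjugate[OF shift Q'])
  also have "\<dots> = translate 1 (block_subst (ins k n) ?P * block_subst (shift k) ?Q)"
    unfolding translate_def
    by (rule rf_subst_mult[symmetric, OF alg_indep_translate block_subst_in_RatFun[OF ins P']
          block_subst_in_RatFun[OF shift Q']])
  also have "block_subst (ins k n) ?P * block_subst (shift k) ?Q = (zprod {1..?N} - 1) * mould_pc m n k P Q"
    unfolding insP shiftQ pc by (simp only: mult_ac)
  finally show ?thesis by (simp only: mould_to_loday_def)
qed

theorem mould_iso_loday: "isomorphic_operads rf_scale RatFun mould_pc rf_scale RatFun loday_pc"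
  unfolding isomorphic_operads_def
proof (intro exI, rule operad_transport[where \<phi> = mould_to_loday, OF mould_operad])
  show "vector_space rf_scale" by unfold_locales
  show "bij_betw (mould_to_loday n) (RatFun n) (RatFun n)" if "n \<ge> 1" for n
    using that by (rule bij_mould_to_loday)
  show "mould_to_loday (m + n - 1) (mould_pc m n k P Q) =
      loday_pc m n k (mould_to_loday m P) (mould_to_loday n Q)"
    if "n \<ge> 1" "k \<in> {1..m}" "P \<in> RatFun m" "Q \<in> RatFun n" for m n k P Q
    using that by (rule mould_to_loday_pc)
  show "mould_to_loday n (P + Q) = mould_to_loday n P + mould_to_loday n Q"
    if "P \<in> RatFun n" "Q \<in> RatFun n" for n P Q
    using that rf_subst_add[OF alg_indep_translate[of n], of "(zprod {1..n} - 1) * P" "(zprod {1..n} - 1) * Q" 1]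
    by (simp add: mould_to_loday_def translate_def distrib_left)
  show "mould_to_loday n (rf_scale c P) = rf_scale c (mould_to_loday n P)"
    if "P \<in> RatFun n" for n c P
    using that rf_subst_scale[OF alg_indep_translate[of n], of "(zprod {1..n} - 1) * P" 1 c]
    by (simp add: mould_to_loday_def translate_def rf_scale_def mult_ac)
qed

section \<open>Chains of sets and packed words\<close>

text \<open>
  The functions \<open>\<Prod>k. 1 / (z^(X\<^sub>k) - 1)\<close> of strictly increasing chains \<open>{} \<subset> X\<^sub>1 \<subset> \<dots> \<subset> X\<^sub>m = X\<close> of
  finite sets. Only the top set is recorded, and the chain is extended at the top: this is the
  recursion used by the product and the composition.
\<close>

inductive chain_fun :: "nat set \<Rightarrow> ratfun \<Rightarrow> bool" where
  empty: "chain_fun {} 1"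
| step: "chain_fun Y f \<Longrightarrow> Y \<subset> X \<Longrightarrow> finite X \<Longrightarrow> chain_fun X (f * inverse (zprod X - 1))"

definition chain_span :: "nat set \<Rightarrow> ratfun set" where
  "chain_span X = rf.span (Collect (chain_fun X))"

lemma chain_fun_RatFun: "chain_fun X f \<Longrightarrow> X \<subseteq> {1..n} \<Longrightarrow> f \<in> RatFun n"
proof (induction rule: chain_fun.induct)
  case (step Y f X)
  have "Y \<subseteq> {1..n}" using step.hyps(2) step.prems by blast
  then have "f \<in> RatFun n" by (rule step.IH)
  with step.prems show ?case
    by (intro RatFun_mult RatFun_inverse RatFun_diff RatFun_zprod RatFun_1)
qed simp

lemma chain_fun_in_span: "chain_fun X f \<Longrightarrow> f \<in> chain_span X"
  unfolding chain_span_def by (rule rf.span_base) simp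

lemma chain_span_RatFun: "X \<subseteq> {1..n} \<Longrightarrow> chain_span X \<subseteq> RatFun n"
  unfolding chain_span_def
  by (rule rf.span_minimal[OF _ subspace_RatFun], rule subsetI, rule chain_fun_RatFun) simp_all

lemma subspace_chain_span: "rf.subspace (chain_span X)"
  unfolding chain_span_def by (rule rf.subspace_span)

lemma chain_span_step:
  assumes f: "f \<in> chain_span Y" and X: "Y \<subset> X" "finite X"
  shows "f * inverse (zprod X - 1) \<in> chain_span X"
proof -
  let ?W = "{f. f * inverse (zprod X - 1) \<in> chain_span X}"
  have "rf.subspace ?W"
    using subspace_chain_span[of X]
    by (auto simp: rf.subspace_def distrib_right rf_scale_def mult.assoc)
  moreover have "Collect (chain_fun Y) \<subseteq> ?W"
    using X by (auto intro: chain_fun_in_span chain_fun.step)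
  ultimately have "chain_span Y \<subseteq> ?W"
    unfolding chain_span_def[of Y] by (intro rf.span_minimal)
  with f show ?thesis by auto
qed

lemma inverse_mult_inverse_identity:
  fixes a b :: "'a::field"
  assumes "a - 1 \<noteq> 0" "b - 1 \<noteq> 0" "a * b - 1 \<noteq> 0"
  shows "inverse (a - 1) * inverse (b - 1) =
    (1 + inverse (a - 1) + inverse (b - 1)) * inverse (a * b - 1)"
proof -
  have "(1 + inverse (a - 1) + inverse (b - 1)) * ((a - 1) * (b - 1)) = a * b - 1"
  proof -
    have "(1 + inverse (a - 1) + inverse (b - 1)) * ((a - 1) * (b - 1))
        = (a - 1) * (b - 1) + (inverse (a - 1) * (a - 1)) * (b - 1) + (inverse (b - 1) * (b - 1)) * (a - 1)"
      by (simp only: distrib_right distrib_left mult_1_left mult_ac)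
    also have "\<dots> = a * b - 1"
      unfolding left_inverse[OF assms(1)] left_inverse[OF assms(2)] by (simp add: algebra_simps)
    finally show ?thesis .
  qed
  then have "inverse ((a - 1) * (b - 1)) = (1 + inverse (a - 1) + inverse (b - 1)) * inverse (a * b - 1)"
    using assms by (intro inverse_unique) (simp add: mult_ac)
  then show ?thesis by (simp only: inverse_mult_distrib)
qed

text \<open>
  The quasi-shuffle product. The identity above replaces the two top factors by \<open>1 / (z^(X \<union> Y) - 1)\<close>
  times products in which at least one of the chains has lost its top set; by induction these are
  sums over chains ending strictly below \<open>X \<union> Y\<close>. Disjointness of \<open>X\<close> and \<open>Y\<close> is what makes
  \<open>z^X z^Y = z^(X \<union> Y)\<close>.
\<close>

lemma chain_fun_mult:
  assumes "chain_fun X f" "chain_fun Y g" "X \<inter> Y = {}"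
  shows "f * g \<in> chain_span (X \<union> Y)"
  using assms
proof (induction arbitrary: Y g rule: chain_fun.induct)
  case empty
  then show ?case by (simp add: chain_fun_in_span)
next
  case (step X' f X)
  from \<open>chain_fun Y g\<close> \<open>X \<inter> Y = {}\<close> show ?case
  proof (induction rule: chain_fun.induct)
    case empty
    show ?case using step.hyps by (auto intro!: chain_fun_in_span chain_fun.step)
  next
    case inner: (step Y' g Y)
    let ?a = "zprod X" and ?b = "zprod Y"
    have fin: "finite (X \<union> Y)" using step.hyps inner.hyps by simp
    have ab: "zprod (X \<union> Y) = ?a * ?b"
      using step.hyps inner.hyps inner.prems by (intro zprod_Un_disjoint) auto
    have nz: "?a - 1 \<noteq> 0" "?b - 1 \<noteq> 0" "?a * ?b - 1 \<noteq> 0"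
      using step.hyps inner.hyps fin unfolding ab[symmetric] by (intro zprod_neq_1; auto)+
    have "f * g \<in> chain_span (X' \<union> Y')"
      using step.hyps inner.hyps inner.prems by (intro step.IH) auto
    then have 1: "f * g * inverse (zprod (X \<union> Y) - 1) \<in> chain_span (X \<union> Y)"
      by (rule chain_span_step) (use step.hyps inner.hyps inner.prems in auto)
    have "f * inverse (?a - 1) * g \<in> chain_span (X \<union> Y')"
      using inner.hyps inner.prems by (intro inner.IH) auto
    then have 2: "f * inverse (?a - 1) * g * inverse (zprod (X \<union> Y) - 1) \<in> chain_span (X \<union> Y)"
      by (rule chain_span_step) (use step.hyps inner.hyps inner.prems in auto)
    have "f * (g * inverse (?b - 1)) \<in> chain_span (X' \<union> Y)"
      using step.hyps inner.hyps inner.prems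
      by (intro step.IH chain_fun.step[OF inner.hyps(1)]) auto
    then have 3: "f * (g * inverse (?b - 1)) * inverse (zprod (X \<union> Y) - 1) \<in> chain_span (X \<union> Y)"
      by (rule chain_span_step) (use step.hyps inner.hyps inner.prems in auto)
    have "f * inverse (?a - 1) * (g * inverse (?b - 1)) = f * g * (inverse (?a - 1) * inverse (?b - 1))"
      by (simp only: mult_ac)
    also have "\<dots> = f * g * inverse (zprod (X \<union> Y) - 1) + f * inverse (?a - 1) * g * inverse (zprod (X \<union> Y) - 1)
        + f * (g * inverse (?b - 1)) * inverse (zprod (X \<union> Y) - 1)"
      unfolding inverse_mult_inverse_identity[OF nz] ab
      by (simp only: distrib_left distrib_right mult_1_left mult_1_right mult_ac)
    finally show ?case
      using 1 2 3 by (simp only: rf.subspace_add[OF subspace_chain_span])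
  qed
qed

lemma UN_blocks_psubset:
  assumes e: "disjoint_blocks n N e" and X: "Y \<subset> X" "X \<subseteq> {1..n}"
  shows "(\<Union>i\<in>Y. e i) \<subset> (\<Union>i\<in>X. e i)"
proof -
  obtain a where a: "a \<in> X" "a \<notin> Y" using X by blast
  have an: "a \<in> {1..n}" using a(1) X(2) by blast
  then obtain j where j: "j \<in> e a" using e by (fastforce simp: disjoint_blocks_def)
  have "e a \<inter> e i = {}" if "i \<in> Y" for i
    by (rule disjoint_blocks_disjoint[OF e an]) (use that a(2) X in auto)
  with j have "j \<notin> (\<Union>i\<in>Y. e i)" by blast
  moreover have "j \<in> (\<Union>i\<in>X. e i)" using a(1) j by blast
  moreover have "(\<Union>i\<in>Y. e i) \<subseteq> (\<Union>i\<in>X. e i)" using X(1) by blast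
  ultimately show ?thesis by (metis psubsetI)
qed

lemma finite_UN_blocks:
  assumes "disjoint_blocks n N e" "X \<subseteq> {1..n}"
  shows "finite (\<Union>i\<in>X. e i)"
proof (rule finite_subset)
  show "(\<Union>i\<in>X. e i) \<subseteq> {1..N}" using assms unfolding disjoint_blocks_def by blast
qed simp

lemma block_subst_chain_step:
  assumes e: "disjoint_blocks n N e" and f: "f \<in> RatFun n" and X: "X \<subseteq> {1..n}"
  shows "block_subst e (f * inverse (zprod X - 1)) =
    block_subst e f * inverse (zprod (\<Union>i\<in>X. e i) - 1)"
proof -
  note indep = alg_indep_blocks[OF e]
  have mem: "zprod X - 1 \<in> RatFun n" using X by simp
  show ?thesis
    unfolding rf_subst_mult[OF indep f RatFun_inverse[OF mem]] rf_subst_inverse[OF indep mem]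
      block_subst_zprod_diff_1[OF e X] ..
qed

lemma chain_fun_block_subst:
  assumes "chain_fun X f" and e: "disjoint_blocks n N e" and X: "X \<subseteq> {1..n}"
  shows "chain_fun (\<Union>i\<in>X. e i) (block_subst e f)"
  using assms(1) X
proof (induction rule: chain_fun.induct)
  case empty
  then show ?case by (simp add: chain_fun.empty)
next
  case (step Y f X)
  have Y: "Y \<subseteq> {1..n}" using step.hyps(2) step.prems by blast
  have f: "f \<in> RatFun n" by (rule chain_fun_RatFun[OF step.hyps(1) Y])
  show ?case
    unfolding block_subst_chain_step[OF e f step.prems]
    by (rule chain_fun.step[OF step.IH[OF Y] UN_blocks_psubset[OF e step.hyps(2) step.prems]
          finite_UN_blocks[OF e step.prems]])
qed

text \<open>
  Inserting a chain ending at the block \<open>e k\<close> into a chain ending at \<open>X\<close>, by recursion on the latter.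
  As long as \<open>k\<close> lies in the next set \<open>Y\<close> below \<open>X\<close>, the top factor is just carried along. When
  \<open>k \<notin> Y\<close>, the image of \<open>Y\<close> is disjoint from \<open>e k\<close> and the factor \<open>z^(e k) - 1\<close>
  cancels the top factor of the inserted chain. What remains is a product of chains whose union of top sets misses a
  point of \<open>e k\<close>, so that the image of \<open>X\<close> is a strictly larger set.
\<close>

lemma chain_fun_insert:
  assumes "chain_fun X f" and e: "disjoint_blocks n N e" and X: "X \<subseteq> {1..n}" "k \<in> X"
    and g: "chain_fun (e k) g"
  shows "(zprod (e k) - 1) * block_subst e f * g \<in> chain_span (\<Union>i\<in>X. e i)"
  using assms(1) X
proof (induction rule: chain_fun.induct)
  case empty
  then show ?case by simp
next
  case (step Y f X)
  let ?U = "\<lambda>X. \<Union>i\<in>X. e i"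
  have Y: "Y \<subseteq> {1..n}" using step.hyps(2) step.prems(1) by blast
  have f: "f \<in> RatFun n" by (rule chain_fun_RatFun[OF step.hyps(1) Y])
  have fin: "finite (?U X)" by (rule finite_UN_blocks[OF e step.prems(1)])
  have sub: "?U Y \<subset> ?U X" by (rule UN_blocks_psubset[OF e step.hyps(2) step.prems(1)])
  have "\<exists>V \<subset> ?U X. (zprod (e k) - 1) * block_subst e f * g \<in> chain_span V"
  proof (cases "k \<in> Y")
    case True
    from sub step.IH[OF Y this] show ?thesis by (intro exI conjI)
  next
    case False
    have k: "k \<in> {1..n}" using step.prems by blast
    have "e k \<noteq> {}" using e k by (simp add: disjoint_blocks_def)
    moreover have "finite (e k)" using disjoint_blocks_finite[OF e k] .
    moreover have "?U Y \<inter> e k = {}"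
    proof -
      have "e i \<inter> e k = {}" if "i \<in> Y" for i
        by (rule disjoint_blocks_disjoint[OF e _ k]) (use that False Y in auto)
      then show ?thesis by blast
    qed
    ultimately have ek: "e k \<noteq> {}" "finite (e k)" "?U Y \<inter> e k = {}" .
    obtain V g' where V: "chain_fun V g'" "V \<subset> e k" and g': "g = g' * inverse (zprod (e k) - 1)"
      using g
    proof cases
      case empty
      with ek(1) show ?thesis by simp
    next
      case (step V g')
      then show ?thesis by (intro that)
    qed
    have "zprod (e k) - 1 \<noteq> 0" using ek by (intro zprod_neq_1) auto
    then have "(zprod (e k) - 1) * block_subst e f * g = block_subst e f * g'"
      unfolding g' by (simp add: field_simps)
    also have "\<dots> \<in> chain_span (?U Y \<union> V)"
      using V ek by (intro chain_fun_mult chain_fun_block_subst[OF step.hyps(1) e Y]) auto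
    finally have in_span: "(zprod (e k) - 1) * block_subst e f * g \<in> chain_span (?U Y \<union> V)" .
    have "e k \<subseteq> ?U X" using step.prems(2) by blast
    moreover have "A \<union> V \<subset> B" if "A \<subseteq> B" "e k \<subseteq> B" "A \<inter> e k = {}" for A B
      using that V(2) by blast
    ultimately have "?U Y \<union> V \<subset> ?U X" using sub ek(3) by simp
    with in_span show ?thesis by (intro exI conjI)
  qed
  then obtain V where V: "V \<subset> ?U X \<and> (zprod (e k) - 1) * block_subst e f * g \<in> chain_span V" ..
  have "(zprod (e k) - 1) * block_subst e (f * inverse (zprod X - 1)) * g
      = (zprod (e k) - 1) * block_subst e f * g * inverse (zprod (?U X) - 1)"
    unfolding block_subst_chain_step[OF e f step.prems(1)] by (simp only: mult_ac)
  then show ?case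
    using chain_span_step[OF V[THEN conjunct2] V[THEN conjunct1] fin] by (simp only:)
qed

text \<open>
  The chain of the sublevel sets of \<open>w\<close>. With \<open>w i\<close> the \<open>i\<close>-th letter of a packed word it gives
  \<open>M\<^sub>u\<close>; arbitrary index sets \<open>X\<close> are allowed for the sake of induction.
\<close>

definition level_fun :: "nat set \<Rightarrow> (nat \<Rightarrow> nat) \<Rightarrow> nat \<Rightarrow> ratfun" where
  "level_fun X w m = (\<Prod>k\<in>{1..m}. inverse (zprod {i\<in>X. w i \<le> k} - 1))"

lemma level_fun_cong:
  assumes "\<And>i. i \<in> X \<Longrightarrow> w i = w' i"
  shows "level_fun X w m = level_fun X w' m"
proof -
  have "{i\<in>X. w i \<le> k} = {i\<in>X. w' i \<le> k}" for k
    using assms by auto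
  then show ?thesis by (simp add: level_fun_def)
qed

lemma level_fun_Suc:
  assumes "w ` X \<subseteq> {1..Suc m}" "Y = {i\<in>X. w i \<le> m}"
  shows "level_fun X w (Suc m) = level_fun Y w m * inverse (zprod X - 1)"
proof -
  have "{i\<in>X. w i \<le> Suc m} = X" using assms by auto
  moreover have "{i\<in>X. w i \<le> k} = {i\<in>Y. w i \<le> k}" if "k \<in> {1..m}" for k
    using that assms by auto
  ultimately show ?thesis by (simp add: level_fun_def)
qed

lemma chain_fun_level_fun:
  "finite X \<Longrightarrow> w ` X = {1..m} \<Longrightarrow> chain_fun X (level_fun X w m)"
proof (induction m arbitrary: X)
  case 0
  then show ?case by (simp add: level_fun_def chain_fun.empty)
next
  case (Suc m)
  let ?Y = "{i\<in>X. w i \<le> m}"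
  have "w ` ?Y = {1..m}"
  proof
    show "{1..m} \<subseteq> w ` ?Y"
    proof
      fix k assume k: "k \<in> {1..m}"
      then have "k \<in> w ` X" unfolding Suc.prems(2) by simp
      with k show "k \<in> w ` ?Y" by auto
    qed
  qed (use Suc.prems(2) in auto)
  then have "chain_fun ?Y (level_fun ?Y w m)"
    using Suc.prems(1) by (intro Suc.IH) auto
  moreover obtain i where "i \<in> X" "w i = Suc m"
    using Suc.prems(2) by (metis atLeastAtMost_iff imageE le_add1 order.refl plus_1_eq_Suc)
  then have "?Y \<subset> X" by force
  ultimately show ?case
    using Suc.prems level_fun_Suc[of w X m ?Y] by (auto intro: chain_fun.step)
qed

lemma chain_fun_levels:
  "chain_fun X f \<Longrightarrow> \<exists>w m. w ` X = {1..m} \<and> f = level_fun X w m"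
proof (induction rule: chain_fun.induct)
  case empty
  show ?case
    by (rule exI[of _ "\<lambda>_. 0"], rule exI[of _ 0]) (simp add: level_fun_def)
next
  case (step Y f X)
  obtain w m where w: "w ` Y = {1..m}" "f = level_fun Y w m"
    using step.IH by (elim exE conjE)
  \<comment> \<open>The new top set of the chain corresponds to a new largest letter.\<close>
  define w' where "w' i = (if i \<in> Y then w i else Suc m)" for i
  have le: "w i \<le> m" if "i \<in> Y" for i
    using w(1) that by auto
  obtain a where a: "a \<in> X" "a \<notin> Y" using step.hyps(2) by blast
  have X: "X = Y \<union> (X - Y)" using step.hyps(2) by blast
  have "w' ` Y = w ` Y" "w' ` (X - Y) = {Suc m}"
    using a by (auto simp: w'_def)
  then have "w' ` X = {1..m} \<union> {Suc m}"
    using w(1) by (metis X image_Un)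
  then have im: "w' ` X = {1..Suc m}"
    by auto
  have Y: "Y = {i\<in>X. w' i \<le> m}"
    using le step.hyps(2) by (auto simp: w'_def)
  have "level_fun Y w' m = level_fun Y w m"
    by (rule level_fun_cong) (simp add: w'_def)
  then have "f * inverse (zprod X - 1) = level_fun X w' (Suc m)"
    using level_fun_Suc[OF _ Y] im w(2) by simp
  with im show ?case by (intro exI conjI)
qed

lemma packed_M_level_fun:
  assumes "set u = {1..m}"
  shows "packed_M u = level_fun {1..length u} (\<lambda>i. u ! (i - 1)) m"
proof -
  let ?X = "{1..length u}"
  have pos: "1 \<le> u ! (i - 1)" if "i \<in> ?X" for i
    using that assms nth_mem[of "i - 1" u] by force
  have "(\<Prod>i\<in>{1..k}. \<Prod>j\<in>letter_positions u i. Z j) = zprod {i\<in>?X. u ! (i - 1) \<le> k}" for k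
  proof -
    have "(\<Prod>i\<in>{1..k}. \<Prod>j\<in>letter_positions u i. Z j) = (\<Prod>j\<in>(\<Union>i\<in>{1..k}. letter_positions u i). Z j)"
      by (rule prod.UNION_disjoint[symmetric]) (auto simp: letter_positions_def)
    moreover have "(\<Union>i\<in>{1..k}. letter_positions u i) = {i\<in>?X. u ! (i - 1) \<le> k}"
      using pos by (auto simp: letter_positions_def)
    ultimately show ?thesis by (simp add: zprod_def)
  qed
  then show ?thesis
    using assms by (simp add: packed_M_def level_fun_def)
qed

text \<open>
  Packed words of length \<open>n\<close> are the same as chains of sets ending at \<open>{1..n}\<close>: strictness of the chain says
  that every letter up to the largest one occurs.
\<close>

lemma packed_M_chain_fun:
  "{packed_M u | u. packed u \<and> length u = n} = Collect (chain_fun {1..n})"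
proof (intro set_eqI iffI)
  fix f assume "f \<in> {packed_M u | u. packed u \<and> length u = n}"
  then obtain u m where u: "f = packed_M u" "set u = {1..m}" "length u = n"
    by (auto simp: packed_def)
  have "(\<lambda>i. u ! (i - 1)) ` {1..n} = set u"
  proof -
    have "u ! i \<in> (\<lambda>i. u ! (i - 1)) ` {1..n}" if "i < n" for i
      using that by (intro image_eqI[of _ _ "Suc i"]) auto
    then have "set u \<subseteq> (\<lambda>i. u ! (i - 1)) ` {1..n}"
      using u(3) by (auto simp: set_conv_nth)
    moreover have "u ! (i - 1) \<in> set u" if "i \<in> {1..n}" for i
      using that u(3) by (intro nth_mem) auto
    ultimately show ?thesis by blast
  qed
  then show "f \<in> Collect (chain_fun {1..n})"
    using u packed_M_level_fun[OF u(2)] chain_fun_level_fun[of "{1..n}" "\<lambda>i. u ! (i - 1)" m] by simp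
next
  fix f assume "f \<in> Collect (chain_fun {1..n})"
  then have "chain_fun {1..n} f" by simp
  then obtain w m where w: "w ` {1..n} = {1..m}" "f = level_fun {1..n} w m"
    using chain_fun_levels by meson
  define u where "u = map w [1..<Suc n]"
  have u: "set u = {1..m}" "length u = n"
    using w(1) by (auto simp: u_def atLeastLessThanSuc_atLeastAtMost simp del: upt_Suc)
  have nth: "u ! (i - 1) = w i" if "i \<in> {1..n}" for i
    using that by (auto simp: u_def simp del: upt_Suc)
  have "packed_M u = level_fun {1..n} (\<lambda>i. u ! (i - 1)) m"
    using packed_M_level_fun[OF u(1)] u(2) by simp
  also have "\<dots> = level_fun {1..n} w m"
    using nth by (rule level_fun_cong)
  finally have "f = packed_M u" using w(2) by simp
  with u show "f \<in> {packed_M u | u. packed u \<and> length u = n}"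
    by (auto simp: packed_def)
qed

lemma packed_span_eq: "packed_span n = chain_span {1..n}"
  unfolding packed_span_def chain_span_def packed_M_chain_fun ..

text \<open>
  The block that the composition puts in place of \<open>k\<close> is \<open>{k..k + n - 1}\<close>, which is also the top
  set of the shifted second chain; so this is an instance of \<open>chain_fun_insert\<close>.
\<close>

lemma mould_pc_chain_fun:
  assumes n: "n \<ge> 1" and k: "k \<in> {1..m}" and f: "chain_fun {1..m} f" and g: "chain_fun {1..n} g"
  shows "mould_pc m n k f g \<in> chain_span {1..m + n - 1}"
proof -
  note ins = disjoint_blocks_ins[OF n k] and shift = disjoint_blocks_shift[OF k, of n]
  have insk: "ins k n k = {k..k + n - 1}"
    using n by (simp add: ins_eq)
  have "(\<Union>i\<in>{1..n}. shift k i) = {k..k + n - 1}"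
    using n k by (subst UN_shift) auto
  then have g': "chain_fun (ins k n k) (block_subst (shift k) g)"
    using chain_fun_block_subst[OF g shift order.refl] insk by simp
  have union: "(\<Union>i\<in>{1..m}. ins k n i) = {1..m + n - 1}"
    unfolding UN_ins using n k by (auto simp: collapse_def)
  have pc: "mould_pc m n k f g =
      (zprod (ins k n k) - 1) * block_subst (ins k n) f * block_subst (shift k) g"
    unfolding insk using n k by (intro mould_pc_blocks) auto
  show ?thesis
    unfolding pc union[symmetric] by (rule chain_fun_insert[OF f ins order.refl k g'])
qed

lemma mould_pc_chain_span:
  assumes n: "n \<ge> 1" and k: "k \<in> {1..m}" and x: "x \<in> chain_span {1..m}" and y: "y \<in> chain_span {1..n}"
  shows "mould_pc m n k x y \<in> chain_span {1..m + n - 1}"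
proof -
  define W where "W = chain_span {1..m + n - 1}"
  have W: "rf.subspace W" unfolding W_def by (rule subspace_chain_span)
  note bilinear = mould_pc_bilinear[OF n k]
  have zero: "mould_pc m n k 0 Q = 0" "mould_pc m n k P 0 = 0" for P Q
    by (simp_all add: mould_pc_def)
  have left: "mould_pc m n k x g \<in> W" if g: "chain_fun {1..n} g" for g
  proof -
    let ?V = "{x \<in> RatFun m. mould_pc m n k x g \<in> W}"
    have gR: "g \<in> RatFun n" by (rule chain_fun_RatFun[OF g order.refl])
    have "rf.subspace ?V"
    proof (rule rf.subspaceI)
      show "0 \<in> ?V" by (simp add: zero rf.subspace_0[OF W])
      show "a + b \<in> ?V" if "a \<in> ?V" "b \<in> ?V" for a b
        using that by (simp add: bilinear(1)[OF _ _ gR gR] rf.subspace_add[OF W])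
      show "rf_scale c a \<in> ?V" if "a \<in> ?V" for c a
        using that by (simp add: bilinear(2)[OF _ _ gR gR, of a a] rf.subspace_scale[OF W])
    qed
    moreover have "f \<in> ?V" if f: "chain_fun {1..m} f" for f
      using mould_pc_chain_fun[OF n k f g, folded W_def] chain_fun_RatFun[OF f order.refl] by simp
    then have "Collect (chain_fun {1..m}) \<subseteq> ?V" by blast
    ultimately have "chain_span {1..m} \<subseteq> ?V"
      unfolding chain_span_def by (intro rf.span_minimal)
    with x show ?thesis by blast
  qed
  have xR: "x \<in> RatFun m" using x chain_span_RatFun[OF order.refl] by (rule subsetD[rotated])
  let ?V = "{y \<in> RatFun n. mould_pc m n k x y \<in> W}"
  have "rf.subspace ?V"
  proof (rule rf.subspaceI)
    show "0 \<in> ?V" by (simp add: zero rf.subspace_0[OF W])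
    show "a + b \<in> ?V" if "a \<in> ?V" "b \<in> ?V" for a b
      using that by (simp add: bilinear(3)[OF xR xR] rf.subspace_add[OF W])
    show "rf_scale c a \<in> ?V" if "a \<in> ?V" for c a
      using that by (simp add: bilinear(4)[OF xR xR, of a a] rf.subspace_scale[OF W])
  qed
  moreover have "g \<in> ?V" if g: "chain_fun {1..n} g" for g
    using left[OF g] chain_fun_RatFun[OF g order.refl] by simp
  then have "Collect (chain_fun {1..n}) \<subseteq> ?V" by blast
  ultimately have "chain_span {1..n} \<subseteq> ?V"
    unfolding chain_span_def by (intro rf.span_minimal)
  with y have "mould_pc m n k x y \<in> W" by blast
  then show ?thesis by (simp only: W_def)
qed

theorem packed_suboperad: "is_suboperad rf_scale RatFun mould_pc packed_span"
proof -
  have "chain_fun {1..1} (1 * inverse (zprod {1..1} - 1))"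
    by (rule chain_fun.step[OF chain_fun.empty]) auto
  then have "inverse (Z 1 - 1) \<in> packed_span 1"
    using chain_fun_in_span[of "{1}"] by (simp add: packed_span_eq)
  then have "\<exists>e\<in>packed_span 1. is_operad_unit RatFun mould_pc e"
    using mould_unit by blast
  moreover have "rf.subspace (packed_span n) \<and> packed_span n \<subseteq> RatFun n" for n
    unfolding packed_span_eq using subspace_chain_span chain_span_RatFun[OF order.refl] by simp
  moreover have "mould_pc m n k x y \<in> packed_span (m + n - 1)"
    if "n \<ge> 1" "k \<in> {1..m}" "x \<in> packed_span m" "y \<in> packed_span n" for m n k x y
    using that unfolding packed_span_eq by (rule mould_pc_chain_span)
  ultimately show ?thesis
    unfolding is_suboperad_def using mould_operad by simp
qed

theorem theorem6p4:
  shows "ns_operad rf_scale RatFun mould_pc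
       \<and> isomorphic_operads rf_scale RatFun mould_pc rf_scale RatFun loday_pc
       \<and> is_suboperad rf_scale RatFun mould_pc packed_span"
  using mould_operad mould_iso_loday packed_suboperad by blast

end
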